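(* Let $\Gamma$ be an infinite (countable) discrete group with property $(\mathrm{T})$ whose only finite-dimensional irreducible unitary representation is the trivial one. Let $p\in C^*(\Gamma)$ be the minimal projection associated to the trivial representation, i.e. the minimal central projection with $\varepsilon(p)=1$, and let $\Delta_{\max}:C^*(\Gamma)\to C^*(\Gamma)\otimes C^*(\Gamma)$ be the comultiplication. Then $\Delta_{\max}(p)$ belongs to the algebraic tensor product $C^*(\Gamma)\otimes_{\mathrm{alg}}C^*(\Gamma)$, but $p\notin\mathbb{C}[\Gamma]$.
   Context: $C^*(\Gamma)$ is the full group $C^*$-algebra, i.e. the algebra $\mathrm{C}(\mathbb{G}_{\max})$ for the compact quantum group $\mathbb{G}$ dual to $\Gamma$, and $\mathbb{C}[\Gamma]=\mathrm{Pol}(\mathbb{G})\subset C^*(\Gamma)$. $\varepsilon:C^*(\Gamma)\to\mathbb{C}$ is the character with $\varepsilon(\gamma)=1$ for all $\gamma\in\Gamma$ (trivial representation), and $\Delta_{\max}$ is the $*$-homomorphism with $\Delta_{\max}(\gamma)=\gamma\otimes\gamma$ for $\gamma\in\Gamma$. $\otimes$ is the spatial tensor product. A projection $p$ in a unital $C^*$-algebra $A$ is minimal if $pAp=\mathbb{C}p$. For $\Gamma$ with property $(\mathrm{T})$ there is a unique minimal projection $p$ of $C^*(\Gamma)$ which is central and satisfies $\varepsilon(p)=1$. *)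

theory Defs
  imports "HOL-Analysis.Analysis" "HOL-Algebra.Group"
begin

section \<open>Complex vector spaces\<close>

class complex_vector = real_vector +
  fixes scaleC :: "complex \<Rightarrow> 'a \<Rightarrow> 'a"  (infixr \<open>*\<^sub>C\<close> 75)
  assumes scaleC_add_right: "c *\<^sub>C (x + y) = c *\<^sub>C x + c *\<^sub>C y"
    and scaleC_add_left: "(c + d) *\<^sub>C x = c *\<^sub>C x + d *\<^sub>C x"
    and scaleC_scaleC: "c *\<^sub>C (d *\<^sub>C x) = (c * d) *\<^sub>C x"
    and scaleC_one: "1 *\<^sub>C x = x"
    and scaleR_scaleC: "r *\<^sub>R x = complex_of_real r *\<^sub>C x"

class complex_normed_vector = complex_vector + real_normed_vector +
  assumes norm_scaleC: "norm (c *\<^sub>C x) = cmod c * norm x"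

interpretation complex_vector: vector_space "scaleC :: complex \<Rightarrow> 'a \<Rightarrow> 'a::complex_vector"
  by unfold_locales (simp_all add: scaleC_add_right scaleC_add_left scaleC_scaleC scaleC_one)

lemma onorm_scaleC:
  fixes f :: "'a::real_normed_vector \<Rightarrow> 'b::complex_normed_vector"
  assumes "bounded_linear f"
  shows "onorm (\<lambda>x. c *\<^sub>C f x) = cmod c * onorm f"
proof -
  have "onorm (\<lambda>x. c *\<^sub>C f x) = onorm (\<lambda>x. cmod c *\<^sub>R f x)"
    by (simp add: onorm_def norm_scaleC)
  then show ?thesis
    using onorm_scaleR[OF assms, of "cmod c"] by simp
qed

lemma bounded_linear_scaleC_comp:
  fixes f :: "'a::real_normed_vector \<Rightarrow> 'b::complex_normed_vector"
  assumes "bounded_linear f"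
  shows "bounded_linear (\<lambda>x. c *\<^sub>C f x)"
proof -
  interpret f: bounded_linear f by fact
  obtain K where K: "\<And>x. norm (f x) \<le> norm x * K"
    using f.bounded by blast
  show ?thesis
  proof (rule bounded_linear_intro[where K = "cmod c * K"])
    show "c *\<^sub>C f (r *\<^sub>R x) = r *\<^sub>R (c *\<^sub>C f x)" for r x
      by (simp add: f.scaleR scaleR_scaleC scaleC_scaleC mult.commute)
    show "norm (c *\<^sub>C f x) \<le> norm x * (cmod c * K)" for x
      using mult_left_mono[OF K[of x], of "cmod c"] by (simp add: norm_scaleC mult.left_commute)
  qed (simp add: f.add scaleC_add_right)
qed

instantiation blinfun :: (real_normed_vector, complex_normed_vector) complex_normed_vector
begin

lift_definition scaleC_blinfun :: "complex \<Rightarrow> 'a \<Rightarrow>\<^sub>L 'b \<Rightarrow> 'a \<Rightarrow>\<^sub>L 'b"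
  is "\<lambda>c f x. c *\<^sub>C f x"
  by (rule bounded_linear_scaleC_comp)

instance
proof
  fix c :: complex and T :: "'a \<Rightarrow>\<^sub>L 'b"
  show "norm (c *\<^sub>C T) = cmod c * norm T"
    by transfer (rule onorm_scaleC)
qed (rule blinfun_eqI, simp add: scaleC_blinfun.rep_eq plus_blinfun.rep_eq scaleR_blinfun.rep_eq
      scaleC_add_right scaleC_add_left scaleC_scaleC scaleR_scaleC)+

end

section \<open>The Hilbert spaces of square-summable families\<close>

typedef 'i ell2 = "{f :: 'i \<Rightarrow> complex. (\<lambda>i. (cmod (f i))\<^sup>2) summable_on UNIV}"
  morphisms coord Abs_ell2
  by (rule exI[of _ "\<lambda>_. 0"]) simp

setup_lifting type_definition_ell2

lemma ell2_add:
  assumes "(\<lambda>i. (cmod (f i))\<^sup>2) summable_on UNIV" "(\<lambda>i. (cmod (g i))\<^sup>2) summable_on UNIV"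
  shows "(\<lambda>i. (cmod (f i + g i))\<^sup>2) summable_on UNIV"
proof (rule summable_on_comparison_test)
  show "(\<lambda>i. 2 * (cmod (f i))\<^sup>2 + 2 * (cmod (g i))\<^sup>2) summable_on UNIV"
    by (intro summable_on_add summable_on_cmult_right assms)
  show "(cmod (f i + g i))\<^sup>2 \<le> 2 * (cmod (f i))\<^sup>2 + 2 * (cmod (g i))\<^sup>2" for i
  proof -
    have "(cmod (f i + g i))\<^sup>2 \<le> (cmod (f i) + cmod (g i))\<^sup>2"
      by (intro power_mono norm_triangle_ineq) simp
    also have "\<dots> \<le> 2 * (cmod (f i))\<^sup>2 + 2 * (cmod (g i))\<^sup>2"
      using zero_le_power2[of "cmod (f i) - cmod (g i)"] by (simp add: power2_eq_square algebra_simps)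
    finally show ?thesis .
  qed
qed simp

lemma ell2_scale:
  assumes "(\<lambda>i. (cmod (f i))\<^sup>2) summable_on UNIV"
  shows "(\<lambda>i. (cmod (c * f i))\<^sup>2) summable_on UNIV"
  using summable_on_cmult_right[OF assms, of "(cmod c)\<^sup>2"]
  by (simp add: norm_mult power_mult_distrib)

lemma ell2_cinner:
  assumes "(\<lambda>i. (cmod (f i))\<^sup>2) summable_on UNIV" "(\<lambda>i. (cmod (g i))\<^sup>2) summable_on UNIV"
  shows "(\<lambda>i. cnj (f i) * g i) summable_on UNIV"
proof (rule Infinite_Sum.abs_summable_summable, rule Infinite_Sum.abs_summable_on_comparison_test')
  show "(\<lambda>i. (cmod (f i))\<^sup>2 + (cmod (g i))\<^sup>2) summable_on UNIV"
    by (intro summable_on_add assms)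
  show "norm (cnj (f i) * g i) \<le> (cmod (f i))\<^sup>2 + (cmod (g i))\<^sup>2" for i
  proof -
    have "2 * (cmod (f i) * cmod (g i)) \<le> (cmod (f i))\<^sup>2 + (cmod (g i))\<^sup>2"
      using zero_le_power2[of "cmod (f i) - cmod (g i)"] by (simp add: power2_eq_square algebra_simps)
    moreover have "0 \<le> cmod (f i) * cmod (g i)" by simp
    ultimately have "cmod (f i) * cmod (g i) \<le> (cmod (f i))\<^sup>2 + (cmod (g i))\<^sup>2"
      by linarith
    then show ?thesis by (simp add: norm_mult)
  qed
qed

lemma summable_coord: "(\<lambda>i. (cmod (coord x i))\<^sup>2) summable_on UNIV"
  using coord[of x] by simp

instantiation ell2 :: (type) complex_vector
begin

lift_definition zero_ell2 :: "'a ell2" is "\<lambda>_. 0" by simp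
lift_definition plus_ell2 :: "'a ell2 \<Rightarrow> 'a ell2 \<Rightarrow> 'a ell2" is "\<lambda>f g i. f i + g i"
  by (simp add: ell2_add)
lift_definition uminus_ell2 :: "'a ell2 \<Rightarrow> 'a ell2" is "\<lambda>f i. - f i" by simp
lift_definition minus_ell2 :: "'a ell2 \<Rightarrow> 'a ell2 \<Rightarrow> 'a ell2" is "\<lambda>f g i. f i - g i"
  subgoal for f g using ell2_add[of f "\<lambda>i. - g i"] by simp
  done
lift_definition scaleC_ell2 :: "complex \<Rightarrow> 'a ell2 \<Rightarrow> 'a ell2" is "\<lambda>c f i. c * f i"
  by (simp add: ell2_scale)
lift_definition scaleR_ell2 :: "real \<Rightarrow> 'a ell2 \<Rightarrow> 'a ell2" is "\<lambda>r f i. complex_of_real r * f i"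
  by (simp add: ell2_scale)

instance
  by standard (transfer; simp add: fun_eq_iff algebra_simps)+

end

definition cinner :: "'i ell2 \<Rightarrow> 'i ell2 \<Rightarrow> complex" where
  "cinner x y = (\<Sum>\<^sub>\<infinity>i. cnj (coord x i) * coord y i)"

lemma summable_cinner: "(\<lambda>i. cnj (coord x i) * coord y i) summable_on UNIV"
  by (rule ell2_cinner[OF summable_coord summable_coord])

lemma cinner_add_left: "cinner (x + y) z = cinner x z + cinner y z"
  using infsum_add[OF summable_cinner[of x z] summable_cinner[of y z]]
  by (simp add: cinner_def plus_ell2.rep_eq algebra_simps)

lemma cinner_commute: "cinner x y = cnj (cinner y x)"
  by (simp add: cinner_def mult.commute flip: infsum_cnj)

lemma cinner_scaleC_right: "cinner x (c *\<^sub>C y) = c * cinner x y"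
  by (simp add: cinner_def scaleC_ell2.rep_eq mult.left_commute infsum_cmult_right')

lemma cinner_scaleC_left: "cinner (c *\<^sub>C x) y = cnj c * cinner x y"
  by (subst (1 2) cinner_commute) (simp add: cinner_scaleC_right)

lemma cinner_self: "cinner x x = complex_of_real (\<Sum>\<^sub>\<infinity>i. (cmod (coord x i))\<^sup>2)"
proof -
  have "cinner x x = (\<Sum>\<^sub>\<infinity>i. complex_of_real ((cmod (coord x i))\<^sup>2))"
    unfolding cinner_def by (rule infsum_cong) (metis complex_norm_square mult.commute)
  also have "\<dots> = complex_of_real (\<Sum>\<^sub>\<infinity>i. (cmod (coord x i))\<^sup>2)"
    unfolding of_real_def by (rule infsum_scaleR_left[OF summable_coord])
  finally show ?thesis .
qed

instantiation ell2 :: (type) real_inner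
begin

definition inner_ell2 :: "'a ell2 \<Rightarrow> 'a ell2 \<Rightarrow> real" where "inner_ell2 x y = Re (cinner x y)"
definition norm_ell2 :: "'a ell2 \<Rightarrow> real" where "norm_ell2 x = sqrt (inner x x)"
definition sgn_ell2 :: "'a ell2 \<Rightarrow> 'a ell2" where "sgn_ell2 x = x /\<^sub>R norm x"
definition dist_ell2 :: "'a ell2 \<Rightarrow> 'a ell2 \<Rightarrow> real" where "dist_ell2 x y = norm (x - y)"
definition uniformity_ell2 :: "('a ell2 \<times> 'a ell2) filter" where
  "uniformity_ell2 = (INF e\<in>{0<..}. principal {(x, y). dist x y < e})"
definition open_ell2 :: "'a ell2 set \<Rightarrow> bool" where
  "open_ell2 U \<longleftrightarrow> (\<forall>x\<in>U. \<forall>\<^sub>F (x', y) in uniformity. x' = x \<longrightarrow> y \<in> U)"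

instance
proof
  fix x y z :: "'a ell2" and r :: real
  show "inner x y = inner y x"
    unfolding inner_ell2_def by (subst cinner_commute) simp
  show "inner (x + y) z = inner x z + inner y z"
    by (simp add: inner_ell2_def cinner_add_left)
  show "inner (r *\<^sub>R x) y = r * inner x y"
    by (simp add: inner_ell2_def scaleR_scaleC cinner_scaleC_left)
  show "0 \<le> inner x x"
    by (simp add: inner_ell2_def cinner_self infsum_nonneg)
  show "inner x x = 0 \<longleftrightarrow> x = 0"
  proof
    assume "inner x x = 0"
    then have "(\<Sum>\<^sub>\<infinity>i. (cmod (coord x i))\<^sup>2) \<le> 0"
      by (simp add: inner_ell2_def cinner_self)
    then have "(cmod (coord x i))\<^sup>2 = 0" for i
      by (rule nonneg_infsum_le_0D[OF _ summable_coord]) auto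
    then show "x = 0"
      by (simp add: coord_inject[symmetric] fun_eq_iff zero_ell2.rep_eq)
  qed (simp add: inner_ell2_def cinner_def zero_ell2.rep_eq)
qed (rule norm_ell2_def sgn_ell2_def dist_ell2_def uniformity_ell2_def open_ell2_def)+

end

lemma norm_ell2_power2: "(norm (x :: 'i ell2))\<^sup>2 = (\<Sum>\<^sub>\<infinity>i. (cmod (coord x i))\<^sup>2)"
  by (simp add: norm_ell2_def inner_ell2_def cinner_self infsum_nonneg)

instance ell2 :: (type) complex_normed_vector
proof
  fix c :: complex and x :: "'a ell2"
  have "(norm (c *\<^sub>C x))\<^sup>2 = (cmod c * norm x)\<^sup>2"
    by (simp add: norm_ell2_power2 power_mult_distrib scaleC_ell2.rep_eq norm_mult infsum_cmult_right')
  then show "norm (c *\<^sub>C x) = cmod c * norm x"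
    by (rule power2_eq_imp_eq) simp_all
qed

lemma finite_sum_coord_le: "finite F \<Longrightarrow> (\<Sum>i\<in>F. (cmod (coord x i))\<^sup>2) \<le> (norm x)\<^sup>2"
  unfolding norm_ell2_power2 by (rule finite_sum_le_infsum[OF summable_coord]) auto

lemma ell2I:
  assumes "\<And>F. finite F \<Longrightarrow> (\<Sum>i\<in>F. (cmod (f i))\<^sup>2) \<le> B\<^sup>2" "0 \<le> B"
  shows "coord (Abs_ell2 f) = f" "norm (Abs_ell2 f) \<le> B"
proof -
  have s: "(\<lambda>i. (cmod (f i))\<^sup>2) summable_on UNIV"
  proof (rule nonneg_bdd_above_summable_on)
    show "bdd_above (sum (\<lambda>i. (cmod (f i))\<^sup>2) ` {F. F \<subseteq> UNIV \<and> finite F})"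
      using assms(1) by (intro bdd_aboveI2[where M = "B\<^sup>2"]) blast
  qed simp
  then show c: "coord (Abs_ell2 f) = f"
    by (simp add: Abs_ell2_inverse)
  have "(norm (Abs_ell2 f))\<^sup>2 \<le> B\<^sup>2"
    unfolding norm_ell2_power2 c by (rule infsum_le_finite_sums[OF s]) (rule assms(1))
  then show "norm (Abs_ell2 f) \<le> B"
    using assms(2) by (rule power2_le_imp_le)
qed

lemma cmod_coord_le: "cmod (coord x i) \<le> norm x"
  by (rule power2_le_imp_le) (use finite_sum_coord_le[of "{i}" x] in simp_all)

instance ell2 :: (type) banach
proof
  fix X :: "nat \<Rightarrow> 'a ell2"
  assume X: "Cauchy X"
  have le: "dist (coord x i) (coord y i) \<le> dist x y" for x y :: "'a ell2" and i
    using cmod_coord_le[of "x - y" i] by (simp add: dist_norm minus_ell2.rep_eq)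
  have "Cauchy (\<lambda>n. coord (X n) i)" for i
  proof (rule metric_CauchyI)
    fix e :: real assume "0 < e"
    from metric_CauchyD[OF X this] obtain M where M: "\<forall>m\<ge>M. \<forall>n\<ge>M. dist (X m) (X n) < e" ..
    show "\<exists>M. \<forall>m\<ge>M. \<forall>n\<ge>M. dist (coord (X m) i) (coord (X n) i) < e"
    proof (intro exI allI impI)
      fix m n assume "M \<le> m" "M \<le> n"
      then show "dist (coord (X m) i) (coord (X n) i) < e"
        using M le_less_trans[OF le] by blast
    qed
  qed
  then have l: "(\<lambda>n. coord (X n) i) \<longlonglongrightarrow> lim (\<lambda>n. coord (X n) i)" for i
    by (simp add: Cauchy_convergent_iff convergent_LIMSEQ_iff)
  define l where "l i = lim (\<lambda>n. coord (X n) i)" for i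
  note l = l[folded l_def]
  have ev: "\<exists>M. \<forall>n\<ge>M. \<forall>F. finite F \<longrightarrow> (\<Sum>i\<in>F. (cmod (coord (X n) i - l i))\<^sup>2) \<le> e\<^sup>2"
    if "0 < e" for e
  proof -
    from metric_CauchyD[OF X that]
    obtain M where M: "\<forall>m\<ge>M. \<forall>n\<ge>M. norm (X m - X n) < e"
      unfolding dist_norm ..
    have "(\<Sum>i\<in>F. (cmod (coord (X n) i - l i))\<^sup>2) \<le> e\<^sup>2" if "n \<ge> M" "finite F" for n F
    proof (rule LIMSEQ_le_const2)
      show "(\<lambda>m. \<Sum>i\<in>F. (cmod (coord (X n) i - coord (X m) i))\<^sup>2)
              \<longlonglongrightarrow> (\<Sum>i\<in>F. (cmod (coord (X n) i - l i))\<^sup>2)"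
        by (intro tendsto_sum tendsto_power tendsto_norm tendsto_diff tendsto_const l)
      show "\<exists>N. \<forall>m\<ge>N. (\<Sum>i\<in>F. (cmod (coord (X n) i - coord (X m) i))\<^sup>2) \<le> e\<^sup>2"
      proof (intro exI allI impI)
        fix m assume "m \<ge> M"
        have "(\<Sum>i\<in>F. (cmod (coord (X n) i - coord (X m) i))\<^sup>2) \<le> (norm (X n - X m))\<^sup>2"
          using finite_sum_coord_le[OF that(2), of "X n - X m"] by (simp add: minus_ell2.rep_eq)
        also have "\<dots> \<le> e\<^sup>2"
          using M that(1) \<open>m \<ge> M\<close> by (intro power_mono less_imp_le norm_ge_zero) blast
        finally show "(\<Sum>i\<in>F. (cmod (coord (X n) i - coord (X m) i))\<^sup>2) \<le> e\<^sup>2" .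
      qed
    qed
    then show ?thesis by (intro exI[of _ M] allI impI)
  qed
  obtain N where N: "\<And>F. finite F \<Longrightarrow> (\<Sum>i\<in>F. (cmod (coord (X N) i - l i))\<^sup>2) \<le> 1\<^sup>2"
    using ev[OF zero_less_one] by blast
  define D where "D = Abs_ell2 (\<lambda>i. coord (X N) i - l i)"
  have D: "coord D = (\<lambda>i. coord (X N) i - l i)"
    unfolding D_def by (rule ell2I(1)[OF N]) simp_all
  define L where "L = X N - D"
  have L: "coord L = l"
    by (simp add: L_def minus_ell2.rep_eq D)
  have "X \<longlonglongrightarrow> L"
  proof (rule metric_LIMSEQ_I)
    fix r :: real assume "0 < r"
    then obtain M where M: "\<And>n F. n \<ge> M \<Longrightarrow> finite F \<Longrightarrow> (\<Sum>i\<in>F. (cmod (coord (X n) i - l i))\<^sup>2) \<le> (r/2)\<^sup>2"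
      using ev[OF half_gt_zero[OF \<open>0 < r\<close>]] by blast
    have "dist (X n) L < r" if "n \<ge> M" for n
    proof -
      have "norm (Abs_ell2 (coord (X n - L))) \<le> r/2"
        unfolding minus_ell2.rep_eq L using M[OF that] \<open>0 < r\<close> by (intro ell2I(2)) simp_all
      then show ?thesis
        using \<open>0 < r\<close> by (simp add: dist_norm coord_inverse)
    qed
    then show "\<exists>M. \<forall>n\<ge>M. dist (X n) L < r" by blast
  qed
  then show "convergent X" unfolding convergent_def by blast
qed


definition unit_vec :: "'i \<Rightarrow> 'i ell2" where
  "unit_vec i = Abs_ell2 (\<lambda>j. if j = i then 1 else 0)"

definition complex_linear :: "('a::complex_normed_vector \<Rightarrow>\<^sub>L 'b::complex_normed_vector) \<Rightarrow> bool" where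
  "complex_linear T \<longleftrightarrow> (\<forall>c x. T (c *\<^sub>C x) = c *\<^sub>C T x)"

lemma ell2_eqI: "(\<And>i. coord x i = coord y i) \<Longrightarrow> x = y"
  by (simp add: coord_inject[symmetric] fun_eq_iff)

lemma coord_unit_vec: "coord (unit_vec i) j = (if j = i then 1 else 0)"
proof -
  have "coord (unit_vec i) = (\<lambda>j. if j = i then 1 else 0)"
    unfolding unit_vec_def
  proof (rule ell2I(1))
    fix F :: "'a set" assume "finite F"
    have "(\<Sum>j\<in>F. (cmod (if j = i then 1 else 0))\<^sup>2) = (\<Sum>j\<in>F. if j = i then 1 else 0)"
      by (rule sum.cong) auto
    then show "(\<Sum>j\<in>F. (cmod (if j = i then 1 else 0))\<^sup>2) \<le> 1\<^sup>2"
      using \<open>finite F\<close> by (simp add: sum.delta)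
  qed simp
  then show ?thesis by simp
qed

lemma coord_sum: "coord (sum f F) i = (\<Sum>a\<in>F. coord (f a) i)"
  by (induction F rule: infinite_finite_induct) (simp_all add: zero_ell2.rep_eq plus_ell2.rep_eq)

lemma coord_truncate:
  assumes "finite F"
  shows "coord (\<Sum>i\<in>F. a i *\<^sub>C unit_vec i) j = (if j \<in> F then a j else 0)"
proof -
  have "coord (\<Sum>i\<in>F. a i *\<^sub>C unit_vec i) j = (\<Sum>i\<in>F. if j = i then a i else 0)"
    unfolding coord_sum by (rule sum.cong) (simp_all add: scaleC_ell2.rep_eq coord_unit_vec)
  then show ?thesis
    using assms by (simp add: sum.delta)
qed

lemma norm_diff_truncate:
  assumes "finite F"
  shows "(norm (x - (\<Sum>i\<in>F. coord x i *\<^sub>C unit_vec i)))\<^sup>2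
           = (norm x)\<^sup>2 - (\<Sum>i\<in>F. (cmod (coord x i))\<^sup>2)"
proof -
  have "(norm (x - (\<Sum>i\<in>F. coord x i *\<^sub>C unit_vec i)))\<^sup>2 = (\<Sum>\<^sub>\<infinity>i\<in>-F. (cmod (coord x i))\<^sup>2)"
    unfolding norm_ell2_power2
    by (rule infsum_cong_neutral) (simp_all add: minus_ell2.rep_eq coord_truncate[OF assms])
  also have "\<dots> = (norm x)\<^sup>2 - (\<Sum>i\<in>F. (cmod (coord x i))\<^sup>2)"
    unfolding norm_ell2_power2 Compl_eq_Diff_UNIV
    by (subst infsum_Diff) (use assms summable_coord in simp_all)
  finally show ?thesis .
qed

lemma closure_span_unit_vec: "closure (complex_vector.span (range unit_vec)) = (UNIV :: 'i ell2 set)"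
proof -
  have "x \<in> closure (complex_vector.span (range unit_vec))" for x :: "'i ell2"
    unfolding closure_approachable
  proof (intro allI impI)
    fix e :: real assume e: "0 < e"
    have "((\<lambda>i. (cmod (coord x i))\<^sup>2) has_sum (norm x)\<^sup>2) UNIV"
      unfolding norm_ell2_power2 by (rule has_sum_infsum[OF summable_coord])
    then have "\<forall>\<^sub>F F in finite_subsets_at_top UNIV. dist (\<Sum>i\<in>F. (cmod (coord x i))\<^sup>2) ((norm x)\<^sup>2) < e\<^sup>2"
      unfolding has_sum_def using e by (intro tendstoD) simp_all
    then obtain F where F: "finite F" "dist (\<Sum>i\<in>F. (cmod (coord x i))\<^sup>2) ((norm x)\<^sup>2) < e\<^sup>2"
      unfolding eventually_finite_subsets_at_top by blast
    let ?y = "\<Sum>i\<in>F. coord x i *\<^sub>C unit_vec i"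
    have "(norm (x - ?y))\<^sup>2 < e\<^sup>2"
      using F(2) unfolding norm_diff_truncate[OF F(1)] dist_real_def by linarith
    then have "norm (x - ?y) < e"
      using e by (intro power2_less_imp_less[of _ e]) simp_all
    moreover have "?y \<in> complex_vector.span (range unit_vec)"
      by (intro complex_vector.span_sum complex_vector.span_scale complex_vector.span_base) simp
    ultimately show "\<exists>y\<in>complex_vector.span (range unit_vec). dist y x < e"
      by (metis dist_norm dist_commute)
  qed
  then show ?thesis by blast
qed

lemma cmod_cinner_le: "cmod (cinner x y) \<le> norm x * norm y"
proof (cases "cinner x y = 0")
  case False
  let ?c = "cnj (cinner x y) / cmod (cinner x y)"
  have "?c * cinner x y = cmod (cinner x y)"
    using False by (simp add: complex_norm_square[symmetric] mult.commute power2_eq_square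
        nonzero_divide_eq_eq)
  then have "cmod (cinner x y) = inner x (?c *\<^sub>C y)"
    by (simp add: inner_ell2_def cinner_scaleC_right)
  also have "\<dots> \<le> norm x * norm (?c *\<^sub>C y)"
    by (rule norm_cauchy_schwarz)
  also have "\<dots> = norm x * norm y"
    using False by (simp add: norm_scaleC norm_divide)
  finally show ?thesis .
qed simp

lemma cinner_unit_vec: "cinner (unit_vec i) x = coord x i"
proof -
  have "cinner (unit_vec i) x = (\<Sum>\<^sub>\<infinity>j\<in>{i}. coord x j)"
    unfolding cinner_def
    by (rule infsum_cong_neutral) (simp_all add: coord_unit_vec)
  then show ?thesis by simp
qed

lemma bounded_linear_ell2_eqI:
  assumes "bounded_linear f" "bounded_linear g"
    and eq: "\<And>c i. f (c *\<^sub>C unit_vec i) = g (c *\<^sub>C unit_vec i)"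
  shows "f x = g x"
proof -
  interpret f: bounded_linear f by fact
  interpret g: bounded_linear g by fact
  have "f x = g x" if "x \<in> complex_vector.span (range unit_vec)" for x
    using that
  proof (induction rule: complex_vector.span_induct_alt)
    case (step c b y)
    then show ?case using eq by (auto simp: f.add g.add)
  qed (simp add: f.zero g.zero)
  moreover have "closed {x. f x = g x}"
    by (intro closed_Collect_eq f.continuous_on g.continuous_on continuous_on_id)
  ultimately have "closure (complex_vector.span (range unit_vec)) \<subseteq> {x. f x = g x}"
    by (intro closure_minimal) auto
  then show ?thesis
    unfolding closure_span_unit_vec by blast
qed

subsection \<open>Adjoints\<close>

definition adj :: "'i ell2 \<Rightarrow>\<^sub>L 'i ell2 \<Rightarrow> 'i ell2 \<Rightarrow>\<^sub>L 'i ell2" where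
  "adj T = (THE S :: 'i ell2 \<Rightarrow>\<^sub>L 'i ell2. \<forall>x y. cinner (T x) y = cinner x (S y))"

lemma cinner_sum_left: "cinner (sum f F) y = (\<Sum>a\<in>F. cinner (f a) y)"
proof (induction F rule: infinite_finite_induct)
qed (simp_all add: cinner_add_left, simp_all add: cinner_def zero_ell2.rep_eq)

lemma cinner_add_right: "cinner x (y + z) = cinner x y + cinner x z"
  by (subst (1 2 3) cinner_commute) (simp add: cinner_add_left)

lemma bounded_linear_cinner_left: "bounded_linear (\<lambda>x. cnj (cinner x y))"
proof (rule bounded_linear_intro[where K = "norm y"])
qed (simp_all add: cinner_add_left scaleR_scaleC cinner_scaleC_left scaleR_conv_of_real cmod_cinner_le)

lemma cinner_adj:
  assumes T: "complex_linear T"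
  shows "cinner (T x) y = cinner x (adj T y)"
proof -
  define f where "f y i = cinner (T (unit_vec i)) y" for y i
  have f: "coord (Abs_ell2 (f y)) = f y" "norm (Abs_ell2 (f y)) \<le> norm T * norm y" for y
  proof -
    have "(\<Sum>i\<in>F. (cmod (f y i))\<^sup>2) \<le> (norm T * norm y)\<^sup>2" if F: "finite F" for F
    proof -
      define v where "v = (\<Sum>i\<in>F. f y i *\<^sub>C unit_vec i)"
      define s where "s = (\<Sum>i\<in>F. (cmod (f y i))\<^sup>2)"
      have "v - (\<Sum>i\<in>F. coord v i *\<^sub>C unit_vec i) = 0"
        by (simp add: v_def coord_truncate[OF F])
      then have nv: "(norm v)\<^sup>2 = s"
        using norm_diff_truncate[OF F, of v] by (simp add: s_def v_def coord_truncate[OF F])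
      have "cinner (T v) y = (\<Sum>i\<in>F. cnj (f y i) * f y i)"
        using T by (simp add: v_def blinfun.sum_right complex_linear_def cinner_sum_left
            cinner_scaleC_left f_def)
      also have "\<dots> = complex_of_real s"
        by (simp add: s_def complex_norm_square mult.commute del: of_real_power)
      finally have "cmod (cinner (T v) y) = \<bar>s\<bar>"
        by (simp only: norm_of_real)
      then have "s = cmod (cinner (T v) y)"
        by (simp add: s_def sum_nonneg)
      also have "\<dots> \<le> norm (T v) * norm y"
        by (rule cmod_cinner_le)
      also have "\<dots> \<le> norm T * norm v * norm y"
        by (intro mult_right_mono norm_blinfun norm_ge_zero)
      finally have "norm v * norm v \<le> norm v * (norm T * norm y)"
        using nv by (simp add: power2_eq_square mult_ac)
      then have "norm v \<le> norm T * norm y"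
        by (cases "norm v = 0") (simp, metis mult_le_cancel_left_pos norm_ge_zero order_le_less)
      then have "(norm v)\<^sup>2 \<le> (norm T * norm y)\<^sup>2"
        by (intro power_mono norm_ge_zero)
      then show ?thesis using nv s_def by simp
    qed
    then show "coord (Abs_ell2 (f y)) = f y" "norm (Abs_ell2 (f y)) \<le> norm T * norm y"
      by (rule ell2I; simp)+
  qed
  have bl: "bounded_linear (\<lambda>y. Abs_ell2 (f y))"
  proof (rule bounded_linear_intro[where K = "norm T"])
    show "Abs_ell2 (f (x + y)) = Abs_ell2 (f x) + Abs_ell2 (f y)" for x y
      by (rule ell2_eqI) (simp add: f(1) plus_ell2.rep_eq, simp add: f_def cinner_add_right)
    show "Abs_ell2 (f (r *\<^sub>R x)) = r *\<^sub>R Abs_ell2 (f x)" for r x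
      by (rule ell2_eqI)
        (simp add: f(1) scaleR_scaleC scaleC_ell2.rep_eq, simp add: f_def cinner_scaleC_right)
  qed (use f(2) in \<open>simp add: mult.commute\<close>)
  define S where "S = Blinfun (\<lambda>y. Abs_ell2 (f y))"
  have S: "cinner (T x) y = cinner x (S y)" for x y
  proof -
    have "cnj (cinner (T x) y) = cnj (cinner x (S y))"
    proof (rule bounded_linear_ell2_eqI[where x = x])
      show "bounded_linear (\<lambda>x. cnj (cinner (T x) y))"
        by (rule bounded_linear_compose[OF bounded_linear_cinner_left blinfun.bounded_linear_right])
      show "bounded_linear (\<lambda>x. cnj (cinner x (S y)))"
        by (rule bounded_linear_cinner_left)
      show "cnj (cinner (T (c *\<^sub>C unit_vec i)) y) = cnj (cinner (c *\<^sub>C unit_vec i) (S y))" for c i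
        using T by (simp add: complex_linear_def cinner_scaleC_left cinner_unit_vec S_def
            bounded_linear_Blinfun_apply[OF bl] f(1) f_def)
    qed
    then show ?thesis by simp
  qed
  have "adj T = S"
    unfolding adj_def
  proof (rule the_equality)
    fix R :: "'a ell2 \<Rightarrow>\<^sub>L 'a ell2" assume R: "\<forall>x y. cinner (T x) y = cinner x (R y)"
    show "R = S"
    proof (rule blinfun_eqI, rule ell2_eqI)
      show "coord (R y) i = coord (S y) i" for y i
        using R S by (metis cinner_unit_vec)
    qed
  qed (use S in blast)
  then show ?thesis using S by simp
qed

subsection \<open>Direct sums and tensor products\<close>

text \<open>
  The space \<^typ>\<open>('k \<times> 'i) ell2\<close> serves both as the Hilbert space direct sum of \<^typ>\<open>'k\<close>-many
  copies of \<^typ>\<open>'i ell2\<close> and as the Hilbert space tensor product of \<^typ>\<open>'k ell2\<close> and \<^typ>\<open>'i ell2\<close>.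
\<close>

definition slice :: "('k \<times> 'i) ell2 \<Rightarrow> 'k \<Rightarrow> 'i ell2" where
  "slice x k = Abs_ell2 (\<lambda>i. coord x (k, i))"

definition direct_sum_op :: "('k \<Rightarrow> 'i ell2 \<Rightarrow> 'i ell2) \<Rightarrow> ('k \<times> 'i) ell2 \<Rightarrow>\<^sub>L ('k \<times> 'i) ell2" where
  "direct_sum_op F = Blinfun (\<lambda>x. Abs_ell2 (\<lambda>(k, i). coord (F k (slice x k)) i))"

definition tensor_vec :: "'i ell2 \<Rightarrow> 'j ell2 \<Rightarrow> ('i \<times> 'j) ell2" where
  "tensor_vec x y = Abs_ell2 (\<lambda>(i, j). coord x i * coord y j)"

definition tensor_op ::
  "'i ell2 \<Rightarrow>\<^sub>L 'i ell2 \<Rightarrow> 'j ell2 \<Rightarrow>\<^sub>L 'j ell2 \<Rightarrow> ('i \<times> 'j) ell2 \<Rightarrow>\<^sub>L ('i \<times> 'j) ell2" where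
  "tensor_op S T = (THE R :: ('i \<times> 'j) ell2 \<Rightarrow>\<^sub>L ('i \<times> 'j) ell2.
     \<forall>x y. R (tensor_vec x y) = tensor_vec (S x) (T y))"

lemma coord_slice:
  fixes x :: "('k \<times> 'i) ell2"
  shows "coord (slice x k) i = coord x (k, i)"
proof -
  have "coord (slice x k) = (\<lambda>i. coord x (k, i))"
    unfolding slice_def
  proof (rule ell2I(1))
    fix F :: "'i set" assume "finite F"
    then show "(\<Sum>i\<in>F. (cmod (coord x (k, i)))\<^sup>2) \<le> (norm x)\<^sup>2"
      using finite_sum_coord_le[of "Pair k ` F" x] by (simp add: sum.reindex inj_on_def)
  qed simp
  then show ?thesis by simp
qed

lemma sum_norm_slice_le:
  assumes "finite K"
  shows "(\<Sum>k\<in>K. (norm (slice x k))\<^sup>2) \<le> (norm x)\<^sup>2"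
proof -
  have s: "(\<lambda>p. (cmod (coord x p))\<^sup>2) summable_on K \<times> UNIV"
    by (rule summable_on_subset_banach[OF summable_coord]) simp
  have "(\<Sum>k\<in>K. (norm (slice x k))\<^sup>2) = (\<Sum>\<^sub>\<infinity>k\<in>K. \<Sum>\<^sub>\<infinity>i. (cmod (coord x (k, i)))\<^sup>2)"
    using assms by (simp add: norm_ell2_power2 coord_slice)
  also have "\<dots> = (\<Sum>\<^sub>\<infinity>p\<in>K \<times> UNIV. (cmod (coord x p))\<^sup>2)"
    by (rule infsum_Sigma_banach[OF s])
  also have "\<dots> \<le> (norm x)\<^sup>2"
    unfolding norm_ell2_power2 by (rule infsum_mono2[OF s summable_coord]) simp_all
  finally show ?thesis .
qed

lemma
  assumes lin: "\<And>k. bounded_linear (F k)"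
    and le: "\<And>k x. norm (F k x) \<le> B * norm x" and B: "0 \<le> B"
  shows slice_direct_sum_op: "slice (direct_sum_op F x) k = F k (slice x k)"
    and norm_direct_sum_op: "norm (direct_sum_op F x) \<le> B * norm x"
proof -
  define G where "G x = (\<lambda>(k, i). coord (F k (slice x k)) i)" for x
  have bound: "(\<Sum>p\<in>P. (cmod (G x p))\<^sup>2) \<le> (B * norm x)\<^sup>2" if "finite P" for P x
  proof -
    have "(\<Sum>p\<in>P. (cmod (G x p))\<^sup>2) \<le> (\<Sum>p\<in>fst ` P \<times> snd ` P. (cmod (G x p))\<^sup>2)"
      using that by (intro sum_mono2) (auto simp: image_iff, force+)
    also have "\<dots> = (\<Sum>k\<in>fst ` P. \<Sum>i\<in>snd ` P. (cmod (coord (F k (slice x k)) i))\<^sup>2)"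
      by (simp add: G_def sum.cartesian_product case_prod_unfold)
    also have "\<dots> \<le> (\<Sum>k\<in>fst ` P. (B * norm (slice x k))\<^sup>2)"
    proof (rule sum_mono)
      fix k
      have "(\<Sum>i\<in>snd ` P. (cmod (coord (F k (slice x k)) i))\<^sup>2) \<le> (norm (F k (slice x k)))\<^sup>2"
        using that by (intro finite_sum_coord_le) simp
      also have "\<dots> \<le> (B * norm (slice x k))\<^sup>2"
        by (intro power_mono le norm_ge_zero)
      finally show "(\<Sum>i\<in>snd ` P. (cmod (coord (F k (slice x k)) i))\<^sup>2) \<le> (B * norm (slice x k))\<^sup>2" .
    qed
    also have "\<dots> = B\<^sup>2 * (\<Sum>k\<in>fst ` P. (norm (slice x k))\<^sup>2)"
      by (simp add: power_mult_distrib sum_distrib_left)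
    also have "\<dots> \<le> B\<^sup>2 * (norm x)\<^sup>2"
      using that by (intro mult_left_mono sum_norm_slice_le) simp_all
    finally show ?thesis by (simp add: power_mult_distrib)
  qed
  have nn: "0 \<le> B * norm x" for x :: "('a \<times> 'b) ell2"
    using B by simp
  have G: "coord (Abs_ell2 (G x)) = G x" "norm (Abs_ell2 (G x)) \<le> B * norm x" for x
    by (rule ell2I[OF bound nn]; assumption)+
  have slice_add: "slice (x + y) k = slice x k + slice y k" for x y :: "('a \<times> 'b) ell2" and k
    by (rule ell2_eqI) (simp add: coord_slice plus_ell2.rep_eq)
  have slice_scale: "slice (r *\<^sub>R x) k = r *\<^sub>R slice x k" for r and x :: "('a \<times> 'b) ell2" and k
    by (rule ell2_eqI) (simp add: coord_slice scaleR_ell2.rep_eq)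
  have bl: "bounded_linear (\<lambda>x. Abs_ell2 (G x))"
  proof (rule bounded_linear_intro[where K = B])
    fix x y :: "('a \<times> 'b) ell2" and r :: real
    show "Abs_ell2 (G (x + y)) = Abs_ell2 (G x) + Abs_ell2 (G y)"
      by (rule ell2_eqI, unfold plus_ell2.rep_eq G(1))
        (simp add: G_def slice_add linear_add[OF bounded_linear.linear[OF lin]] plus_ell2.rep_eq
          split: prod.splits)
    show "Abs_ell2 (G (r *\<^sub>R x)) = r *\<^sub>R Abs_ell2 (G x)"
      by (rule ell2_eqI, unfold scaleR_ell2.rep_eq G(1))
        (simp add: G_def slice_scale linear_scale[OF bounded_linear.linear[OF lin]]
          scaleR_ell2.rep_eq split: prod.splits)
    show "norm (Abs_ell2 (G x)) \<le> norm x * B"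
      using G(2)[of x] by (simp add: mult.commute)
  qed
  have app: "direct_sum_op F x = Abs_ell2 (G x)" for x
    unfolding direct_sum_op_def G_def[symmetric] bounded_linear_Blinfun_apply[OF bl] ..
  show "slice (direct_sum_op F x) k = F k (slice x k)"
    by (rule ell2_eqI) (simp add: coord_slice app G(1), simp add: G_def)
  show "norm (direct_sum_op F x) \<le> B * norm x"
    unfolding app by (rule G(2))
qed

lemma coord_tensor_vec: "coord (tensor_vec x y) (i, j) = coord x i * coord y j"
proof -
  have "coord (tensor_vec x y) = (\<lambda>(i, j). coord x i * coord y j)"
    unfolding tensor_vec_def
  proof (rule ell2I(1))
    fix P :: "('a \<times> 'b) set" assume P: "finite P"
    let ?f = "\<lambda>(i, j). coord x i * coord y j"
    have "(\<Sum>p\<in>P. (cmod (?f p))\<^sup>2) \<le> (\<Sum>p\<in>fst ` P \<times> snd ` P. (cmod (?f p))\<^sup>2)"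
      using P by (intro sum_mono2) (auto simp: image_iff, force+)
    also have "\<dots> = (\<Sum>i\<in>fst ` P. (cmod (coord x i))\<^sup>2) * (\<Sum>j\<in>snd ` P. (cmod (coord y j))\<^sup>2)"
      by (simp add: sum_product sum.cartesian_product case_prod_unfold norm_mult power_mult_distrib)
    also have "\<dots> \<le> (norm x)\<^sup>2 * (norm y)\<^sup>2"
      using P by (intro mult_mono finite_sum_coord_le sum_nonneg) simp_all
    finally show "(\<Sum>p\<in>P. (cmod (?f p))\<^sup>2) \<le> (norm x * norm y)\<^sup>2"
      by (simp add: power_mult_distrib)
  qed simp
  then show ?thesis by simp
qed

lemma slice_tensor_vec: "slice (tensor_vec x y) i = coord x i *\<^sub>C y"
  by (rule ell2_eqI) (simp add: coord_slice coord_tensor_vec scaleC_ell2.rep_eq)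

definition flip :: "('i \<times> 'j) ell2 \<Rightarrow> ('j \<times> 'i) ell2" where
  "flip x = Abs_ell2 (\<lambda>(j, i). coord x (i, j))"

lemma
  fixes x :: "('i \<times> 'j) ell2"
  shows coord_flip: "coord (flip x) (j, i) = coord x (i, j)"
    and norm_flip_le: "norm (flip x) \<le> norm x"
proof -
  have b: "(\<Sum>p\<in>P. (cmod (case p of (j, i) \<Rightarrow> coord x (i, j)))\<^sup>2) \<le> (norm x)\<^sup>2"
    if "finite P" for P :: "('j \<times> 'i) set"
  proof -
    have "(\<Sum>p\<in>P. (cmod (case p of (j, i) \<Rightarrow> coord x (i, j)))\<^sup>2)
        = (\<Sum>p\<in>prod.swap ` P. (cmod (coord x p))\<^sup>2)"
      by (subst sum.reindex) (auto simp: case_prod_unfold prod.swap_def)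
    then show ?thesis
      using finite_sum_coord_le[of "prod.swap ` P" x] that by simp
  qed
  have "coord (flip x) = (\<lambda>(j, i). coord x (i, j))"
    unfolding flip_def by (rule ell2I(1)[OF b norm_ge_zero])
  then show "coord (flip x) (j, i) = coord x (i, j)"
    by simp
  show "norm (flip x) \<le> norm x"
    unfolding flip_def by (rule ell2I(2)[OF b norm_ge_zero])
qed

lemma bounded_linear_flip: "bounded_linear flip"
proof (rule bounded_linear_intro[where K = 1])
  show "flip (x + y) = flip x + flip y" for x y :: "('i \<times> 'j) ell2"
    by (rule ell2_eqI) (auto simp: coord_flip plus_ell2.rep_eq)
  show "flip (r *\<^sub>R x) = r *\<^sub>R flip x" for r and x :: "('i \<times> 'j) ell2"
    by (rule ell2_eqI) (auto simp: coord_flip scaleR_ell2.rep_eq)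
qed (simp add: norm_flip_le)

lemma flip_tensor_vec: "flip (tensor_vec x y) = tensor_vec y x"
  by (rule ell2_eqI) (auto simp: coord_flip coord_tensor_vec)

lemma tensor_unit_vec: "c *\<^sub>C unit_vec (i, j) = tensor_vec (c *\<^sub>C unit_vec i) (unit_vec j)"
  by (rule ell2_eqI) (auto simp: coord_tensor_vec coord_unit_vec scaleC_ell2.rep_eq split: if_splits)

lemma direct_sum_op_tensor_vec:
  assumes "complex_linear T"
  shows "direct_sum_op (\<lambda>_. blinfun_apply T) (tensor_vec x y) = tensor_vec x (T y)"
proof -
  have "slice (direct_sum_op (\<lambda>_. blinfun_apply T) (tensor_vec x y)) k = slice (tensor_vec x (T y)) k" for k
    by (subst slice_direct_sum_op[where B = "norm T"])
      (use assms in \<open>auto simp: blinfun.bounded_linear_right norm_blinfun slice_tensor_vec complex_linear_def\<close>)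
  then show ?thesis
    by (intro ell2_eqI) (metis coord_slice surj_pair)
qed

lemma tensor_op_apply:
  fixes S :: "'i ell2 \<Rightarrow>\<^sub>L 'i ell2" and T :: "'j ell2 \<Rightarrow>\<^sub>L 'j ell2"
  assumes "complex_linear S" "complex_linear T"
  shows "tensor_op S T (tensor_vec x y) = tensor_vec (S x) (T y)"
proof -
  let ?F = "\<lambda>z. flip (direct_sum_op (\<lambda>_. blinfun_apply S) (flip (direct_sum_op (\<lambda>_. blinfun_apply T) z)))"
  have "bounded_linear ?F"
    by (intro bounded_linear_compose[OF bounded_linear_flip]
        bounded_linear_compose[OF blinfun.bounded_linear_right] blinfun.bounded_linear_right)
  then have *: "Blinfun ?F (tensor_vec x y) = tensor_vec (S x) (T y)" for x y
    by (simp add: bounded_linear_Blinfun_apply direct_sum_op_tensor_vec assms flip_tensor_vec)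
  have "tensor_op S T = Blinfun ?F"
    unfolding tensor_op_def
  proof (rule the_equality)
    fix R :: "('i \<times> 'j) ell2 \<Rightarrow>\<^sub>L ('i \<times> 'j) ell2"
    assume R: "\<forall>x y. R (tensor_vec x y) = tensor_vec (S x) (T y)"
    show "R = Blinfun ?F"
    proof (rule blinfun_eqI, rule bounded_linear_ell2_eqI[where f = "blinfun_apply R"])
      fix c and p :: "'i \<times> 'j"
      show "R (c *\<^sub>C unit_vec p) = Blinfun ?F (c *\<^sub>C unit_vec p)"
        by (cases p) (simp add: tensor_unit_vec R *)
    qed (rule blinfun.bounded_linear_right)+
  qed (use * in blast)
  then show ?thesis using * by simp
qed

section \<open>Unitary representations\<close>

text \<open>
  A representation space is a closed subspace \<open>K\<close> of some \<open>\<ell>\<^sup>2\<close>-space. A representation is only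
  constrained on \<open>K\<close> and on the carrier of the group.
\<close>

definition unitary_rep ::
  "('g, 'm) monoid_scheme \<Rightarrow> 'i ell2 set \<Rightarrow> ('g \<Rightarrow> 'i ell2 \<Rightarrow> 'i ell2) \<Rightarrow> bool" where
  "unitary_rep G K \<pi> \<longleftrightarrow>
     complex_vector.subspace K \<and> closed K \<and>
     (\<forall>g\<in>carrier G. \<pi> g ` K = K \<and>
        (\<forall>x\<in>K. \<forall>y\<in>K. \<pi> g (x + y) = \<pi> g x + \<pi> g y \<and> cinner (\<pi> g x) (\<pi> g y) = cinner x y) \<and>
        (\<forall>c. \<forall>x\<in>K. \<pi> g (c *\<^sub>C x) = c *\<^sub>C \<pi> g x)) \<and>
     (\<forall>g\<in>carrier G. \<forall>h\<in>carrier G. \<forall>x\<in>K. \<pi> (g \<otimes>\<^bsub>G\<^esub> h) x = \<pi> g (\<pi> h x))"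

definition irreducible_rep ::
  "('g, 'm) monoid_scheme \<Rightarrow> 'i ell2 set \<Rightarrow> ('g \<Rightarrow> 'i ell2 \<Rightarrow> 'i ell2) \<Rightarrow> bool" where
  "irreducible_rep G K \<pi> \<longleftrightarrow> unitary_rep G K \<pi> \<and> K \<noteq> {0} \<and>
     (\<forall>L. complex_vector.subspace L \<and> closed L \<and> L \<subseteq> K \<and> (\<forall>g\<in>carrier G. \<pi> g ` L \<subseteq> L)
        \<longrightarrow> L = {0} \<or> L = K)"

definition finite_dimensional :: "'a::complex_vector set \<Rightarrow> bool" where
  "finite_dimensional K \<longleftrightarrow> (\<exists>B. finite B \<and> K = complex_vector.span B)"

definition trivial_rep ::
  "('g, 'm) monoid_scheme \<Rightarrow> 'i ell2 set \<Rightarrow> ('g \<Rightarrow> 'i ell2 \<Rightarrow> 'i ell2) \<Rightarrow> bool" where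
  "trivial_rep G K \<pi> \<longleftrightarrow> (\<exists>v. v \<noteq> 0 \<and> K = complex_vector.span {v}) \<and>
     (\<forall>g\<in>carrier G. \<forall>x\<in>K. \<pi> g x = x)"

text \<open>
  Every separable Hilbert space is isomorphic to a closed subspace of \<^typ>\<open>nat ell2\<close>. Hence
  quantifying over such subspaces covers all finite-dimensional representations and, for a
  countable group, all cyclic ones; for property (T) the latter suffice, since one can pass
  to the cyclic subrepresentation generated by an almost invariant vector.
\<close>

definition only_trivial_fd_irreps :: "('g, 'm) monoid_scheme \<Rightarrow> bool" where
  "only_trivial_fd_irreps G \<longleftrightarrow>
     (\<forall>(K :: nat ell2 set) \<pi>. irreducible_rep G K \<pi> \<and> finite_dimensional K \<longrightarrow> trivial_rep G K \<pi>)"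

definition property_T :: "('g, 'm) monoid_scheme \<Rightarrow> bool" where
  "property_T G \<longleftrightarrow>
     (\<exists>Q \<epsilon>. finite Q \<and> Q \<subseteq> carrier G \<and> \<epsilon> > 0 \<and>
        (\<forall>(K :: nat ell2 set) \<pi>. unitary_rep G K \<pi> \<and>
           (\<exists>x\<in>K. x \<noteq> 0 \<and> (\<forall>g\<in>Q. norm (\<pi> g x - x) < \<epsilon> * norm x)) \<longrightarrow>
           (\<exists>x\<in>K. x \<noteq> 0 \<and> (\<forall>g\<in>carrier G. \<pi> g x = x))))"

section \<open>The full group C*-algebra\<close>

text \<open>
  The universal representation is the direct sum of all unitary representations on
  \<^typ>\<open>nat ell2\<close>. For a countable group every cyclic representation is contained in one of these
  (add infinitely many copies of the trivial representation), so that the norm closure of the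
  span of the group is the full group C*-algebra. Indices that are not representations
  contribute further copies of the trivial representation.
\<close>

type_synonym 'g univ_index = "('g \<Rightarrow> nat ell2 \<Rightarrow> nat ell2) \<times> nat"
type_synonym 'i operator = "'i ell2 \<Rightarrow>\<^sub>L 'i ell2"

definition univ_rep :: "('g, 'm) monoid_scheme \<Rightarrow> 'g \<Rightarrow> 'g univ_index operator" where
  "univ_rep G g = direct_sum_op (\<lambda>\<pi>. if unitary_rep G UNIV \<pi> then \<pi> g else id)"

definition group_algebra :: "('g, 'm) monoid_scheme \<Rightarrow> 'g univ_index operator set" where
  "group_algebra G = complex_vector.span (univ_rep G ` carrier G)"

definition full_cstar :: "('g, 'm) monoid_scheme \<Rightarrow> 'g univ_index operator set" where
  "full_cstar G = closure (group_algebra G)"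

lemma slice_univ_rep:
  assumes g: "g \<in> carrier G"
  shows "slice (univ_rep G g x) \<pi> = (if unitary_rep G UNIV \<pi> then \<pi> g else id) (slice x \<pi>)"
  unfolding univ_rep_def
proof (rule slice_direct_sum_op[where B = 1])
  fix \<pi> :: "'a \<Rightarrow> nat ell2 \<Rightarrow> nat ell2"
  have n: "norm (\<pi> g x) = norm x" if "unitary_rep G UNIV \<pi>" for x
    using that g by (simp add: unitary_rep_def norm_ell2_def inner_ell2_def)
  then show "norm ((if unitary_rep G UNIV \<pi> then \<pi> g else id) x) \<le> 1 * norm x" for x
    by simp
  have "bounded_linear (\<pi> g)" if "unitary_rep G UNIV \<pi>"
    by (rule bounded_linear_intro[where K = 1])
      (use that g n in \<open>simp_all add: unitary_rep_def scaleR_scaleC\<close>)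
  then show "bounded_linear (if unitary_rep G UNIV \<pi> then \<pi> g else id)"
    by (simp add: id_def)
qed simp

section \<open>Tensor products, homomorphisms and projections\<close>

definition alg_tensor :: "'i operator set \<Rightarrow> 'j operator set \<Rightarrow> ('i \<times> 'j) operator set" where
  "alg_tensor A B = complex_vector.span {tensor_op a b | a b. a \<in> A \<and> b \<in> B}"

definition spatial_tensor :: "'i operator set \<Rightarrow> 'j operator set \<Rightarrow> ('i \<times> 'j) operator set" where
  "spatial_tensor A B = closure (alg_tensor A B)"

definition star_hom :: "'i operator set \<Rightarrow> 'j operator set \<Rightarrow> ('i operator \<Rightarrow> 'j operator) \<Rightarrow> bool" where
  "star_hom A B \<phi> \<longleftrightarrow>
     (\<forall>a\<in>A. \<phi> a \<in> B \<and> \<phi> (adj a) = adj (\<phi> a) \<and> (\<forall>c. \<phi> (c *\<^sub>C a) = c *\<^sub>C \<phi> a)) \<and>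
     (\<forall>a\<in>A. \<forall>b\<in>A. \<phi> (a + b) = \<phi> a + \<phi> b \<and> \<phi> (a o\<^sub>L b) = \<phi> a o\<^sub>L \<phi> b)"

definition character :: "'i operator set \<Rightarrow> ('i operator \<Rightarrow> complex) \<Rightarrow> bool" where
  "character A \<phi> \<longleftrightarrow> (\<exists>a\<in>A. \<phi> a \<noteq> 0) \<and>
     (\<forall>a\<in>A. \<phi> (adj a) = cnj (\<phi> a) \<and> (\<forall>c. \<phi> (c *\<^sub>C a) = c * \<phi> a)) \<and>
     (\<forall>a\<in>A. \<forall>b\<in>A. \<phi> (a + b) = \<phi> a + \<phi> b \<and> \<phi> (a o\<^sub>L b) = \<phi> a * \<phi> b)"

definition trivial_character ::
  "('g, 'm) monoid_scheme \<Rightarrow> ('g univ_index operator \<Rightarrow> complex) \<Rightarrow> bool" where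
  "trivial_character G \<epsilon> \<longleftrightarrow>
     character (full_cstar G) \<epsilon> \<and> (\<forall>g\<in>carrier G. \<epsilon> (univ_rep G g) = 1)"

definition comultiplication ::
  "('g, 'm) monoid_scheme \<Rightarrow>
     ('g univ_index operator \<Rightarrow> ('g univ_index \<times> 'g univ_index) operator) \<Rightarrow> bool" where
  "comultiplication G \<Delta> \<longleftrightarrow>
     star_hom (full_cstar G) (spatial_tensor (full_cstar G) (full_cstar G)) \<Delta> \<and>
     (\<forall>g\<in>carrier G. \<Delta> (univ_rep G g) = tensor_op (univ_rep G g) (univ_rep G g))"

definition minimal_projection :: "'i operator set \<Rightarrow> 'i operator \<Rightarrow> bool" where
  "minimal_projection A p \<longleftrightarrow> p \<in> A \<and> p o\<^sub>L p = p \<and> adj p = p \<and>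
     {p o\<^sub>L a o\<^sub>L p | a. a \<in> A} = {c *\<^sub>C p | c. True}"

definition central_in :: "'i operator set \<Rightarrow> 'i operator \<Rightarrow> bool" where
  "central_in A p \<longleftrightarrow> p \<in> A \<and> (\<forall>a\<in>A. a o\<^sub>L p = p o\<^sub>L a)"

end

theory Submission
  imports Defs
begin

text \<open>
  The element \<open>p\<close> is the projection onto the invariant vectors of the universal representation \<open>u\<close>:
  by minimality \<open>u g p\<close> is a multiple of \<open>p\<close>, and applying \<open>\<epsilon>\<close> shows that it equals \<open>p\<close>; conversely,
  any element \<open>a\<close> of the algebra multiplies an invariant vector by \<open>\<epsilon> a\<close>
  (\<open>full_cstar_fixed_vector\<close>). The theorem follows from \<open>\<Delta> p = p \<otimes> p\<close>, which is visibly
  in the algebraic tensor product.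

  The range of the projection \<open>\<Delta> p\<close> consists of vectors that are invariant under \<open>u g \<otimes> u g\<close> for
  all \<open>g\<close>. Such a vector is a Hilbert-Schmidt map that intertwines the group action. If it were not
  contained in the tensor square of the invariant vectors, then the part of it that is orthogonal
  to the invariant vectors in one leg would be a nonzero compact intertwiner, whose
  vectors of maximal stretch form a finite-dimensional invariant subspace without nonzero fixed
  vectors. Since every irreducible finite-dimensional representation is trivial, there is no such
  subspace (\<open>invariant_tensor_absorbs_projection\<close>). So \<open>\<Delta> p\<close> is dominated by \<open>p \<otimes> p\<close>.

  In the other direction, \<open>\<Delta> p\<close> fixes \<open>x \<otimes> y\<close> for invariant \<open>x\<close> and \<open>y\<close>: this vector is an
  eigenvector of every operator in the spatial tensor product, and the eigenvalue of \<open>\<Delta> a\<close> is a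
  multiplicative functional of \<open>a\<close> that agrees with \<open>\<epsilon>\<close> on the group, hence everywhere because
  multiplicative functionals are contractive (\<open>comultiplication_fixes_tensor\<close>).

  Finally \<open>p\<close> is not in the group algebra: in the regular representation an element of the group
  algebra that absorbs the group yields a finitely supported constant function on an
  infinite set, so that its augmentation is \<open>0\<close>
  (\<open>group_algebra_invariant_augmentation\<close>), whereas \<open>\<epsilon> p = 1\<close>.
\<close>

section \<open>Compact antilinear maps\<close>

lemma coord_scaleC: "coord (c *\<^sub>C x) i = c * coord x i"
  by (simp add: scaleC_ell2.rep_eq)

lemma coord_minus: "coord (x - y) i = coord x i - coord y i"
  by (simp add: minus_ell2.rep_eq)

definition restrict_coords :: "'i set \<Rightarrow> 'i ell2 \<Rightarrow> 'i ell2" where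
  "restrict_coords F x = (\<Sum>i\<in>F. coord x i *\<^sub>C unit_vec i)"

lemma coord_restrict_coords:
  "finite F \<Longrightarrow> coord (restrict_coords F x) i = (if i \<in> F then coord x i else 0)"
  by (simp add: restrict_coords_def coord_truncate)

lemma norm_minus_restrict_coords_le:
  assumes "finite F" shows "norm (x - restrict_coords F x) \<le> norm x"
proof -
  have "(norm (x - restrict_coords F x))\<^sup>2 \<le> (norm x)\<^sup>2"
    unfolding restrict_coords_def norm_diff_truncate[OF assms] by (simp add: sum_nonneg)
  then show ?thesis by (rule power2_le_imp_le) simp
qed

lemma restrict_coords_approx:
  assumes "0 < e"
  obtains F where "finite F" "norm (x - restrict_coords F x) < e"
proof -
  have "((\<lambda>i. (cmod (coord x i))\<^sup>2) has_sum (norm x)\<^sup>2) UNIV"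
    unfolding norm_ell2_power2 by (rule has_sum_infsum[OF summable_coord])
  then have "\<forall>\<^sub>F F in finite_subsets_at_top UNIV. dist (\<Sum>i\<in>F. (cmod (coord x i))\<^sup>2) ((norm x)\<^sup>2) < e\<^sup>2"
    unfolding has_sum_def using assms by (intro tendstoD) simp_all
  then obtain F where F: "finite F" "dist (\<Sum>i\<in>F. (cmod (coord x i))\<^sup>2) ((norm x)\<^sup>2) < e\<^sup>2"
    unfolding eventually_finite_subsets_at_top by blast
  then have "(norm (x - restrict_coords F x))\<^sup>2 < e\<^sup>2"
    unfolding restrict_coords_def norm_diff_truncate[OF F(1)] dist_real_def by linarith
  then have "norm (x - restrict_coords F x) < e"
    using assms by (intro power2_less_imp_less[of _ e]) simp_all
  with F(1) that show ?thesis by blast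
qed

text \<open>
  Being small on all vectors that vanish on a suitable finite set of coordinates says that the map
  is a norm limit of maps of finite rank, which on a Hilbert space is compactness.
\<close>

definition compact_antilinear :: "('i ell2 \<Rightarrow> 'j ell2) \<Rightarrow> bool" where
  "compact_antilinear S \<longleftrightarrow> bounded_linear S \<and> (\<forall>c x. S (c *\<^sub>C x) = cnj c *\<^sub>C S x) \<and>
     (\<forall>e>0. \<exists>F. finite F \<and> (\<forall>x. (\<forall>i\<in>F. coord x i = 0) \<longrightarrow> norm (S x) \<le> e * norm x))"

lemma compact_ball_functions:
  "compact {f :: 'i \<Rightarrow> complex. \<forall>F. finite F \<longrightarrow> (\<Sum>i\<in>F. (cmod (f i))\<^sup>2) \<le> 1}" (is "compact ?K")
proof -
  have "compactin (product_topology (\<lambda>_. euclidean) UNIV) (PiE UNIV (\<lambda>_::'i. cball (0::complex) 1))"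
    unfolding compactin_PiE by simp
  then have "compact (PiE UNIV (\<lambda>_::'i. cball (0::complex) 1))"
    by (simp add: euclidean_product_topology)
  moreover have "closed ?K"
  proof -
    have "?K = (\<Inter>F\<in>Collect finite. {f. (\<Sum>i\<in>F. (cmod (f i))\<^sup>2) \<le> 1})"
      by auto
    moreover have "closed {f :: 'i \<Rightarrow> complex. (\<Sum>i\<in>F. (cmod (f i))\<^sup>2) \<le> 1}" for F
      by (intro closed_Collect_le continuous_intros continuous_on_product_coordinates)
    ultimately show ?thesis by auto
  qed
  moreover have "?K \<subseteq> PiE UNIV (\<lambda>_::'i. cball (0::complex) 1)"
  proof
    fix f :: "'i \<Rightarrow> complex" assume f: "f \<in> ?K"
    have "cmod (f i) \<le> 1" for i
    proof -
      have "(\<Sum>i\<in>{i}. (cmod (f i))\<^sup>2) \<le> 1" using f by blast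
      then show ?thesis by (simp add: power_le_one_iff)
    qed
    then show "f \<in> PiE UNIV (\<lambda>_::'i. cball (0::complex) 1)" by (simp add: PiE_iff)
  qed
  ultimately show ?thesis
    using compact_Int_closed[of "PiE UNIV (\<lambda>_::'i. cball (0::complex) 1)" ?K] by (simp add: Int_absorb1)
qed

text \<open>
  The unit ball is compact for coordinatewise convergence by Tychonoff's theorem. On it
  \<open>x \<mapsto> norm (S x)\<close> is a uniform limit of functions of finitely many coordinates, hence continuous,
  and so it has a maximum.
\<close>

lemma compact_antilinear_attains_norm:
  fixes S :: "'i ell2 \<Rightarrow> 'j ell2"
  assumes S: "compact_antilinear S"
  obtains m where "\<And>x. norm (S x) \<le> m * norm x" "0 \<le> m" "\<exists>x. x \<noteq> 0 \<and> norm (S x) = m * norm x"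
proof -
  define K where "K = {f :: 'i \<Rightarrow> complex. \<forall>F. finite F \<longrightarrow> (\<Sum>i\<in>F. (cmod (f i))\<^sup>2) \<le> 1}"
  have K: "coord (Abs_ell2 f) = f" "norm (Abs_ell2 f) \<le> 1" if "f \<in> K" for f
    using that unfolding K_def by (intro ell2I[where B = 1]; simp)+
  have KI: "coord x \<in> K" if "norm x \<le> 1" for x
    unfolding K_def
  proof (clarify)
    fix F :: "'i set" assume "finite F"
    then have "(\<Sum>i\<in>F. (cmod (coord x i))\<^sup>2) \<le> (norm x)\<^sup>2" by (rule finite_sum_coord_le)
    also have "\<dots> \<le> 1" using that by (simp add: power_le_one)
    finally show "(\<Sum>i\<in>F. (cmod (coord x i))\<^sup>2) \<le> 1" .
  qed
  interpret S: bounded_linear S using S by (simp add: compact_antilinear_def)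
  have Sc: "S (c *\<^sub>C x) = cnj c *\<^sub>C S x" for c x
    using S by (simp add: compact_antilinear_def)
  have "\<exists>F. finite F \<and> (\<forall>x. (\<forall>i\<in>F. coord x i = 0) \<longrightarrow> norm (S x) \<le> inverse (real (Suc n)) * norm x)" for n
    using S unfolding compact_antilinear_def by simp
  then obtain F where F: "\<And>n. finite (F n)"
    "\<And>n x. (\<forall>i\<in>F n. coord x i = 0) \<Longrightarrow> norm (S x) \<le> inverse (real (Suc n)) * norm x"
    by metis
  define q where "q n f = norm (\<Sum>i\<in>F n. cnj (f i) *\<^sub>C S (unit_vec i))" for n f
  have qS: "q n (coord x) = norm (S (restrict_coords (F n) x))" for n x
    by (simp add: q_def restrict_coords_def S.sum Sc)
  have close: "\<bar>q n (coord x) - norm (S x)\<bar> \<le> inverse (real (Suc n))" if "norm x \<le> 1" for n x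
  proof -
    have "\<bar>q n (coord x) - norm (S x)\<bar> \<le> norm (S (restrict_coords (F n) x) - S x)"
      unfolding qS by (rule norm_triangle_ineq3)
    also have "\<dots> = norm (S (x - restrict_coords (F n) x))"
      by (simp add: S.diff norm_minus_commute)
    also have "\<dots> \<le> inverse (real (Suc n)) * norm (x - restrict_coords (F n) x)"
      by (rule F(2)) (simp add: coord_minus coord_restrict_coords F(1))
    also have "\<dots> \<le> inverse (real (Suc n)) * 1"
      using norm_minus_restrict_coords_le[OF F(1), of x n] that by (intro mult_left_mono) auto
    finally show ?thesis by simp
  qed
  have "continuous_on K (\<lambda>f. norm (S (Abs_ell2 f)))"
  proof (rule uniform_limit_theorem[where F = sequentially and f = q])
    have bl: "bounded_linear (\<lambda>c. cnj c *\<^sub>C v)" for v :: "'j ell2"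
      by (rule bounded_linear_intro[where K = "norm v"])
        (simp_all add: scaleC_add_left norm_scaleC scaleR_scaleC scaleC_scaleC scaleR_conv_of_real)
    show "\<forall>\<^sub>F n in sequentially. continuous_on K (q n)"
      unfolding q_def
      by (intro always_eventually allI continuous_on_norm continuous_on_sum
          bounded_linear.continuous_on[OF bl] continuous_on_subset[OF continuous_on_product_coordinates]) simp
    show "uniform_limit K q (\<lambda>f. norm (S (Abs_ell2 f))) sequentially"
    proof (rule uniform_limitI)
      fix e :: real assume "0 < e"
      then obtain N where N: "inverse (real (Suc N)) < e" using reals_Archimedean by blast
      show "\<forall>\<^sub>F n in sequentially. \<forall>f\<in>K. dist (q n f) (norm (S (Abs_ell2 f))) < e"
      proof (rule eventually_sequentiallyI[of N], rule)
        fix n f assume "N \<le> n" "f \<in> K"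
        have "dist (q n f) (norm (S (Abs_ell2 f))) \<le> inverse (real (Suc n))"
          using close[OF K(2)[OF \<open>f \<in> K\<close>]] K(1)[OF \<open>f \<in> K\<close>] by (simp add: dist_real_def)
        also have "\<dots> \<le> inverse (real (Suc N))" using \<open>N \<le> n\<close> by simp
        finally show "dist (q n f) (norm (S (Abs_ell2 f))) < e" using N by simp
      qed
    qed
  qed simp
  moreover have "compact K" unfolding K_def by (rule compact_ball_functions)
  moreover have "coord 0 \<in> K" by (rule KI) simp
  ultimately obtain f where f: "f \<in> K" "\<And>g. g \<in> K \<Longrightarrow> norm (S (Abs_ell2 g)) \<le> norm (S (Abs_ell2 f))"
    using continuous_attains_sup[of K "\<lambda>f. norm (S (Abs_ell2 f))"] by blast
  define m where "m = norm (S (Abs_ell2 f))"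
  have m: "norm (S x) \<le> m * norm x" for x
  proof (cases "x = 0")
    case False
    have "norm (S (x /\<^sub>R norm x)) \<le> m"
      using f(2)[OF KI[of "x /\<^sub>R norm x"]] False by (simp add: m_def coord_inverse)
    then show ?thesis using False by (simp add: S.scaleR field_simps)
  qed simp
  have "\<exists>x. x \<noteq> 0 \<and> norm (S x) = m * norm x"
  proof (cases "m = 0")
    case True
    have "unit_vec undefined \<noteq> (0::'i ell2)"
      using coord_unit_vec[of undefined "undefined :: 'i"] by (metis zero_ell2.rep_eq zero_neq_one)
    then show ?thesis using m True by (metis mult_zero_left norm_le_zero_iff norm_zero)
  next
    case False
    then have "Abs_ell2 f \<noteq> 0" unfolding m_def by auto
    moreover have "m \<le> m * norm (Abs_ell2 f)" using m[of "Abs_ell2 f"] by (simp add: m_def)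
    moreover have "m * norm (Abs_ell2 f) \<le> m" using K(2)[OF f(1)] by (simp add: m_def mult_left_le)
    ultimately show ?thesis unfolding m_def by (metis order_antisym)
  qed
  moreover have "0 \<le> m" by (simp add: m_def)
  ultimately show ?thesis using m that by blast
qed

text \<open>
  If \<open>m\<close> is the norm of \<open>S\<close>, this is the top eigenspace of \<open>S\<^sup>* S\<close>. The parallelogram law
  shows directly that it is closed under sums. A maximizing vector that vanishes on a set of
  coordinates outside of which \<open>S\<close> has norm at most \<open>m / 2\<close> is zero, so that finitely many
  coordinates determine the vectors of this set.
\<close>

lemma compact_antilinear_maximizers:
  fixes S :: "'i ell2 \<Rightarrow> 'j ell2"
  assumes S: "compact_antilinear S" and m: "\<And>x. norm (S x) \<le> m * norm x" "0 < m"
  defines "M \<equiv> {x. norm (S x) = m * norm x}"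
  shows "complex_vector.subspace M" "closed M" "finite_dimensional M"
proof -
  interpret S: bounded_linear S using S by (simp add: compact_antilinear_def)
  have Sc: "S (c *\<^sub>C x) = cnj c *\<^sub>C S x" for c x
    using S by (simp add: compact_antilinear_def)
  have par: "(norm (x + y))\<^sup>2 + (norm (x - y))\<^sup>2 = 2 * (norm x)\<^sup>2 + 2 * (norm y)\<^sup>2" for x y :: "'k ell2"
    by (simp add: power2_norm_eq_inner algebra_simps inner_commute)
  have le: "(norm (S x))\<^sup>2 \<le> m\<^sup>2 * (norm x)\<^sup>2" for x
    using power_mono[OF m(1)] by (simp add: power_mult_distrib)
  have M: "x \<in> M \<longleftrightarrow> (norm (S x))\<^sup>2 = m\<^sup>2 * (norm x)\<^sup>2" for x
    using m(2) by (simp add: M_def flip: power_mult_distrib)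
  have add: "x + y \<in> M" if "x \<in> M" "y \<in> M" for x y
  proof -
    have "(norm (S (x + y)))\<^sup>2 + (norm (S (x - y)))\<^sup>2 = 2 * (norm (S x))\<^sup>2 + 2 * (norm (S y))\<^sup>2"
      unfolding S.add S.diff by (rule par)
    also have "\<dots> = m\<^sup>2 * (2 * (norm x)\<^sup>2 + 2 * (norm y)\<^sup>2)"
      using that by (simp add: M algebra_simps)
    also have "\<dots> = m\<^sup>2 * (norm (x + y))\<^sup>2 + m\<^sup>2 * (norm (x - y))\<^sup>2"
      unfolding par[symmetric] by (simp add: algebra_simps)
    finally show ?thesis using le[of "x + y"] le[of "x - y"] unfolding M by linarith
  qed
  show sub: "complex_vector.subspace M"
    by (rule complex_vector.subspaceI)
      (use add in \<open>simp_all add: M_def S.zero Sc norm_scaleC\<close>)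
  show "closed M"
    unfolding M_def by (intro closed_Collect_eq continuous_intros S.continuous_on)
  obtain F where F: "finite F" "\<And>x. (\<forall>i\<in>F. coord x i = 0) \<Longrightarrow> norm (S x) \<le> m / 2 * norm x"
    using S m(2) unfolding compact_antilinear_def by (meson half_gt_zero)
  have zero: "x = 0" if "x \<in> M" "\<forall>i\<in>F. coord x i = 0" for x
  proof -
    have "m * norm x \<le> m / 2 * norm x" using F(2)[OF that(2)] that(1) by (simp add: M_def)
    then have "m * norm x \<le> 0" by linarith
    then show ?thesis using m(2) by (simp add: mult_le_0_iff)
  qed
  interpret vs: vector_space_pair "scaleC :: complex \<Rightarrow> 'i ell2 \<Rightarrow> 'i ell2" "scaleC :: complex \<Rightarrow> 'i ell2 \<Rightarrow> 'i ell2" ..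
  have "Vector_Spaces.linear scaleC scaleC (restrict_coords F :: 'i ell2 \<Rightarrow> _)"
    unfolding Vector_Spaces.linear_iff
    by (intro conjI allI complex_vector.vector_space_axioms; rule ell2_eqI) (simp_all add: coord_restrict_coords F(1) plus_ell2.rep_eq coord_scaleC)
  note lin = this
  obtain B where B: "B \<subseteq> M" "complex_vector.independent B" "M \<subseteq> complex_vector.span B"
    using complex_vector.maximal_independent_subset by blast
  have span: "complex_vector.span B = M"
    using B sub by (simp add: complex_vector.span_minimal subset_antisym)
  have inj: "inj_on (restrict_coords F) (complex_vector.span B)"
  proof (rule inj_onI)
    fix x y assume xy: "x \<in> complex_vector.span B" "y \<in> complex_vector.span B" "restrict_coords F x = restrict_coords F y"
    have "\<forall>i\<in>F. coord (x - y) i = 0"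
      using arg_cong[OF xy(3), of coord] by (auto simp: fun_eq_iff coord_restrict_coords F(1) coord_minus split: if_splits)
    moreover have "x - y \<in> M" using xy sub unfolding span by (simp add: complex_vector.subspace_diff)
    ultimately show "x = y" using zero by fastforce
  qed
  then have "complex_vector.independent (restrict_coords F ` B)"
    using vs.linear_independent_injective_image[OF lin] B(2) by blast
  moreover have "restrict_coords F ` B \<subseteq> complex_vector.span (unit_vec ` F)"
    unfolding restrict_coords_def
    by (intro image_subsetI complex_vector.span_sum complex_vector.span_scale complex_vector.span_base imageI)
  ultimately have "finite (restrict_coords F ` B)"
    using complex_vector.independent_span_bound[of "unit_vec ` F"] F(1) by blast
  then have "finite B"
    using inj by (meson complex_vector.span_superset finite_imageD inj_on_subset)
  then show "finite_dimensional M" unfolding finite_dimensional_def using span by blast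
qed

section \<open>Finite-dimensional invariant subspaces\<close>

lemma finite_dimensional_subspace:
  assumes M: "finite_dimensional M" and L: "complex_vector.subspace L" "L \<subseteq> M"
  obtains B where "finite B" "complex_vector.independent B" "complex_vector.span B = L"
    "card B = complex_vector.dim L"
proof -
  obtain C where C: "finite C" "M = complex_vector.span C"
    using M unfolding finite_dimensional_def by blast
  obtain B where B: "B \<subseteq> L" "complex_vector.independent B" "L \<subseteq> complex_vector.span B"
    using complex_vector.maximal_independent_subset by blast
  have "finite B"
    using complex_vector.independent_span_bound[OF C(1) B(2)] B(1) L(2) C(2) by blast
  moreover have "complex_vector.span B = L"
    using B L(1) by (simp add: complex_vector.span_minimal subset_antisym)
  ultimately show ?thesis
    using that B(2) complex_vector.dim_span_eq_card_independent[OF B(2)] by simp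
qed

lemma finite_dimensional_subspace_eqI:
  assumes K: "finite_dimensional K" "complex_vector.subspace K"
    and L: "complex_vector.subspace L" "L \<subseteq> K"
    and dim: "complex_vector.dim K \<le> complex_vector.dim L"
  shows "L = K"
proof (rule ccontr)
  assume "L \<noteq> K"
  then obtain x where x: "x \<in> K" "x \<notin> L" using L(2) by blast
  obtain B where B: "finite B" "complex_vector.independent B" "complex_vector.span B = L"
    "card B = complex_vector.dim L"
    using finite_dimensional_subspace[OF K(1) L] .
  obtain C where C: "finite C" "complex_vector.independent C" "complex_vector.span C = K"
    "card C = complex_vector.dim K"
    using finite_dimensional_subspace[OF K order_refl] .
  have "complex_vector.independent (insert x B)"
    using B x(2) by (simp add: complex_vector.independent_insertI)
  moreover have "insert x B \<subseteq> complex_vector.span C"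
    using B(3) C(3) x(1) L(2) complex_vector.span_superset by blast
  ultimately have "card (insert x B) \<le> card C"
    using complex_vector.independent_span_bound[OF C(1)] by blast
  moreover have "x \<notin> B" using x(2) B(3) complex_vector.span_superset by blast
  ultimately show False using dim B C by simp
qed

lemma unitary_rep_one:
  assumes "group G" "unitary_rep G K \<pi>" "x \<in> K"
  shows "\<pi> \<one>\<^bsub>G\<^esub> x = x"
proof -
  interpret group G by fact
  obtain y where "y \<in> K" "x = \<pi> \<one>\<^bsub>G\<^esub> y"
    using assms(2,3) unfolding unitary_rep_def by blast
  then show ?thesis
    using assms(2) unfolding unitary_rep_def by (metis one_closed r_one)
qed

lemma unitary_rep_restrict:
  assumes G: "group G" and rep: "unitary_rep G UNIV \<pi>"
    and K: "complex_vector.subspace K" "closed K" "\<And>g. g \<in> carrier G \<Longrightarrow> \<pi> g ` K \<subseteq> K"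
  shows "unitary_rep G K \<pi>"
proof -
  interpret group G by fact
  have "K \<subseteq> \<pi> g ` K" if g: "g \<in> carrier G" for g
  proof
    fix x assume "x \<in> K"
    then have "\<pi> (inv\<^bsub>G\<^esub> g) x \<in> K" using K(3) g by blast
    moreover have "\<pi> g (\<pi> (inv\<^bsub>G\<^esub> g) x) = \<pi> (g \<otimes>\<^bsub>G\<^esub> inv\<^bsub>G\<^esub> g) x"
      using rep g inv_closed[OF g] unfolding unitary_rep_def by (metis UNIV_I)
    then have "\<pi> g (\<pi> (inv\<^bsub>G\<^esub> g) x) = x"
      using g unitary_rep_one[OF G rep] by simp
    ultimately show "x \<in> \<pi> g ` K" by (metis imageI)
  qed
  with rep K show ?thesis
    unfolding unitary_rep_def by (auto simp: set_eq_subset)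
qed

text \<open>
  A nonzero invariant subspace whose dimension is least among the closed ones is irreducible, hence
  trivial.
\<close>

lemma finite_dimensional_invariant_fixed_vector:
  fixes M :: "nat ell2 set"
  assumes G: "group G" and only: "only_trivial_fd_irreps G" and rep: "unitary_rep G UNIV \<pi>"
    and M: "complex_vector.subspace M" "closed M" "finite_dimensional M" "M \<noteq> {0}"
    and inv: "\<And>g. g \<in> carrier G \<Longrightarrow> \<pi> g ` M \<subseteq> M"
  obtains v where "v \<in> M" "v \<noteq> 0" "\<And>g. g \<in> carrier G \<Longrightarrow> \<pi> g v = v"
proof -
  define good where "good L \<longleftrightarrow> complex_vector.subspace L \<and> closed L \<and> L \<subseteq> M \<and> L \<noteq> {0} \<and>
    (\<forall>g\<in>carrier G. \<pi> g ` L \<subseteq> L)" for L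
  have "good M" using M inv by (simp add: good_def)
  then obtain K where K: "good K" "\<And>L. good L \<Longrightarrow> complex_vector.dim K \<le> complex_vector.dim L"
    using ex_has_least_nat[of good M complex_vector.dim] by blast
  have Ksub: "complex_vector.subspace K" "closed K" "K \<subseteq> M" "K \<noteq> {0}"
    "\<And>g. g \<in> carrier G \<Longrightarrow> \<pi> g ` K \<subseteq> K"
    using K(1) by (auto simp: good_def)
  obtain B where "finite B" "complex_vector.span B = K"
    using finite_dimensional_subspace[OF M(3) Ksub(1,3)] .
  then have fd: "finite_dimensional K" unfolding finite_dimensional_def by blast
  have "L = {0} \<or> L = K"
    if L: "complex_vector.subspace L" "closed L" "L \<subseteq> K" "\<forall>g\<in>carrier G. \<pi> g ` L \<subseteq> L" for L
  proof (cases "L = {0}")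
    case False
    then have "good L" using L Ksub(3) by (auto simp: good_def)
    then show ?thesis
      using finite_dimensional_subspace_eqI[OF fd Ksub(1) L(1,3)] K(2) by blast
  qed simp
  then have "irreducible_rep G K \<pi>"
    unfolding irreducible_rep_def
    using unitary_rep_restrict[OF G rep Ksub(1,2,5)] Ksub(4) by blast
  then have triv: "trivial_rep G K \<pi>"
    using only fd unfolding only_trivial_fd_irreps_def by blast
  then obtain v where v: "v \<noteq> 0" "K = complex_vector.span {v}"
    unfolding trivial_rep_def by blast
  then have "v \<in> K" by (simp add: complex_vector.span_base)
  then show ?thesis
    using that v(1) triv Ksub(3) unfolding trivial_rep_def by blast
qed

section \<open>Vectors of a tensor product as Hilbert-Schmidt maps\<close>

lemma slice_add: "slice (x + y) k = slice x k + slice y k"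
  by (rule ell2_eqI) (simp add: coord_slice plus_ell2.rep_eq)

lemma slice_diff: "slice (x - y) k = slice x k - slice y k"
  by (rule ell2_eqI) (simp add: coord_slice minus_ell2.rep_eq)

lemma slice_scaleC: "slice (c *\<^sub>C x) k = c *\<^sub>C slice x k"
  by (rule ell2_eqI) (simp add: coord_slice coord_scaleC)

lemma slice_eqI: "(\<And>k. slice x k = slice y k) \<Longrightarrow> x = y"
  by (intro ell2_eqI) (metis coord_slice surj_pair)

lemma cinner_zero [simp]: "cinner x 0 = 0" "cinner 0 x = 0"
  by (simp_all add: cinner_def zero_ell2.rep_eq)

lemma cinner_diff_left: "cinner (x - y) z = cinner x z - cinner y z"
  using cinner_add_left[of "x - y" y z] by simp

lemma cinner_diff_right: "cinner x (y - z) = cinner x y - cinner x z"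
  using cinner_add_right[of x "y - z" z] by simp

text \<open>
  A vector of a tensor product is turned into the Hilbert-Schmidt map that pairs it with a vector of
  the second factor. The pairing is antilinear because \<^const>\<open>cinner\<close> is antilinear in its first
  argument; this avoids conjugate representations.
\<close>

definition contract :: "('j \<times> 'i) ell2 \<Rightarrow> 'i ell2 \<Rightarrow> 'j ell2" where
  "contract Y z = Abs_ell2 (\<lambda>j. cinner z (slice Y j))"

lemma coord_contract: "coord (contract Y z) j = cinner z (slice Y j)"
  and norm_contract_le: "norm (contract Y z) \<le> norm z * norm Y"
proof -
  have "(\<Sum>j\<in>F. (cmod (cinner z (slice Y j)))\<^sup>2) \<le> (norm z * norm Y)\<^sup>2" if "finite F" for F
  proof -
    have "(\<Sum>j\<in>F. (cmod (cinner z (slice Y j)))\<^sup>2) \<le> (\<Sum>j\<in>F. (norm z * norm (slice Y j))\<^sup>2)"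
      by (intro sum_mono power_mono cmod_cinner_le norm_ge_zero)
    also have "\<dots> = (norm z)\<^sup>2 * (\<Sum>j\<in>F. (norm (slice Y j))\<^sup>2)"
      by (simp add: power_mult_distrib sum_distrib_left)
    also have "\<dots> \<le> (norm z)\<^sup>2 * (norm Y)\<^sup>2"
      by (intro mult_left_mono sum_norm_slice_le that) simp
    finally show ?thesis by (simp add: power_mult_distrib)
  qed
  then show "coord (contract Y z) j = cinner z (slice Y j)" "norm (contract Y z) \<le> norm z * norm Y"
    unfolding contract_def
    using ell2I[of "\<lambda>j. cinner z (slice Y j)" "norm z * norm Y"] by simp_all
qed

lemma contract_add: "contract Y (x + z) = contract Y x + contract Y z"
  by (rule ell2_eqI) (simp add: coord_contract plus_ell2.rep_eq cinner_add_left)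

lemma contract_scaleC: "contract Y (c *\<^sub>C z) = cnj c *\<^sub>C contract Y z"
  by (rule ell2_eqI) (simp add: coord_contract coord_scaleC cinner_scaleC_left)

lemma contract_zero: "contract Y 0 = 0"
  by (rule ell2_eqI) (simp add: coord_contract zero_ell2.rep_eq)

lemma cinner_contract: "cinner x (contract Y z) = cinner (tensor_vec x z) Y"
proof -
  have "cinner (tensor_vec x z) Y = (\<Sum>\<^sub>\<infinity>(j, i)\<in>UNIV \<times> UNIV. cnj (coord x j * coord z i) * coord Y (j, i))"
    unfolding cinner_def UNIV_Times_UNIV by (rule infsum_cong) (auto simp: coord_tensor_vec)
  also have "\<dots> = (\<Sum>\<^sub>\<infinity>j. \<Sum>\<^sub>\<infinity>i. cnj (coord x j * coord z i) * coord Y (j, i))"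
  proof (subst infsum_Sigma_banach[symmetric])
    show "(\<lambda>(j, i). cnj (coord x j * coord z i) * coord Y (j, i)) summable_on UNIV \<times> UNIV"
      using summable_cinner[of "tensor_vec x z" Y]
      unfolding UNIV_Times_UNIV
      by (rule summable_on_cong[THEN iffD1, rotated]) (auto simp: coord_tensor_vec)
  qed simp
  also have "\<dots> = cinner x (contract Y z)"
    by (simp add: cinner_def coord_contract coord_slice mult.assoc infsum_cmult_right')
  finally show ?thesis by simp
qed

lemma cinner_slice: "cinner (tensor_vec (unit_vec k) x) y = cinner x (slice y k)"
  using cinner_contract[of "unit_vec k" y x] by (simp add: cinner_unit_vec coord_contract)

text \<open>
  Approximating \<open>Y\<close> by a vector with finitely many coordinates approximates \<open>contract Y\<close> in norm,
  and the approximating map only sees the second components of these coordinates.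
\<close>

lemma compact_antilinear_contract: "compact_antilinear (contract Y)"
  unfolding compact_antilinear_def
proof (intro conjI allI impI)
  show "bounded_linear (contract Y)"
    by (rule bounded_linear_intro[where K = "norm Y"])
      (simp_all add: contract_add scaleR_scaleC contract_scaleC norm_contract_le)
  fix e :: real assume "0 < e"
  then obtain P where P: "finite P" "norm (Y - restrict_coords P Y) < e"
    using restrict_coords_approx by blast
  let ?F = "snd ` P"
  have "norm (contract Y x) \<le> e * norm x" if x: "\<forall>i\<in>?F. coord x i = 0" for x
  proof -
    have "cinner x (slice Y j) = cinner x (slice (Y - restrict_coords P Y) j)" for j
    proof -
      have "cnj (coord x i) * coord (slice (restrict_coords P Y) j) i = 0" for i
        using x by (force simp: coord_slice coord_restrict_coords P(1))
      then have "cinner x (slice (restrict_coords P Y) j) = 0"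
        unfolding cinner_def by (intro infsum_0) blast
      then show ?thesis by (simp add: slice_diff cinner_diff_right)
    qed
    then have "contract Y x = contract (Y - restrict_coords P Y) x"
      by (intro ell2_eqI) (simp add: coord_contract)
    then have "norm (contract Y x) \<le> norm x * norm (Y - restrict_coords P Y)"
      by (simp add: norm_contract_le)
    also have "\<dots> \<le> norm x * e" using P(2) by (intro mult_left_mono) auto
    finally show ?thesis by (simp add: mult.commute)
  qed
  then show "\<exists>F. finite F \<and> (\<forall>x. (\<forall>i\<in>F. coord x i = 0) \<longrightarrow> norm (contract Y x) \<le> e * norm x)"
    using P(1) by (intro exI[of _ ?F]) simp
qed (rule contract_scaleC)

lemma tensor_vec_add_right: "tensor_vec x (y + z) = tensor_vec x y + tensor_vec x z"
  by (rule ell2_eqI) (auto simp: coord_tensor_vec plus_ell2.rep_eq algebra_simps)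

lemma tensor_vec_scaleC_right: "tensor_vec x (c *\<^sub>C y) = c *\<^sub>C tensor_vec x y"
  by (rule ell2_eqI) (auto simp: coord_tensor_vec coord_scaleC)

lemma tensor_vec_scaleC_left: "tensor_vec (c *\<^sub>C x) y = c *\<^sub>C tensor_vec x y"
  by (rule ell2_eqI) (auto simp: coord_tensor_vec coord_scaleC)

lemma cinner_flip: "cinner (tensor_vec z x) (flip Y) = cinner (tensor_vec x z) Y"
proof -
  have "cinner (tensor_vec z x) (flip Y)
      = (\<Sum>\<^sub>\<infinity>q. cnj (coord (tensor_vec z x) (prod.swap q)) * coord (flip Y) (prod.swap q))"
    unfolding cinner_def
    by (rule infsum_reindex_bij_betw[symmetric]) (simp add: bij_swap)
  also have "\<dots> = cinner (tensor_vec x z) Y"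
    unfolding cinner_def
    by (rule infsum_cong) (auto simp: coord_flip coord_tensor_vec mult.commute)
  finally show ?thesis .
qed

lemma norm_tensor_vec_unit: "norm (tensor_vec (unit_vec k) x) = norm x"
proof -
  have "slice (tensor_vec (unit_vec k) x) k = x"
    by (rule ell2_eqI) (simp add: coord_slice coord_tensor_vec coord_unit_vec)
  then have "cinner (tensor_vec (unit_vec k) x) (tensor_vec (unit_vec k) x) = cinner x x"
    by (simp add: cinner_slice)
  then show ?thesis by (simp add: norm_ell2_def inner_ell2_def)
qed

lemma compact_antilinear_embed:
  assumes S: "compact_antilinear S"
  shows "compact_antilinear (\<lambda>x. S (tensor_vec (unit_vec k) x))"
  unfolding compact_antilinear_def
proof (intro conjI allI impI)
  have "bounded_linear (tensor_vec (unit_vec k))"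
    by (rule bounded_linear_intro[where K = 1])
      (simp_all add: tensor_vec_add_right scaleR_scaleC tensor_vec_scaleC_right norm_tensor_vec_unit)
  then show "bounded_linear (\<lambda>x. S (tensor_vec (unit_vec k) x))"
    using S unfolding compact_antilinear_def by (metis bounded_linear_compose)
  show "S (tensor_vec (unit_vec k) (c *\<^sub>C x)) = cnj c *\<^sub>C S (tensor_vec (unit_vec k) x)" for c x
    using S by (simp add: compact_antilinear_def tensor_vec_scaleC_right)
  fix e :: real assume "0 < e"
  then obtain F where F: "finite F" "\<And>x. (\<forall>i\<in>F. coord x i = 0) \<Longrightarrow> norm (S x) \<le> e * norm x"
    using S unfolding compact_antilinear_def by blast
  have "norm (S (tensor_vec (unit_vec k) x)) \<le> e * norm x" if "\<forall>i\<in>snd ` F. coord x i = 0" for x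
  proof -
    have "\<forall>i\<in>F. coord (tensor_vec (unit_vec k) x) i = 0"
      using that by (auto simp: coord_tensor_vec)
    from F(2)[OF this] show ?thesis by (simp add: norm_tensor_vec_unit)
  qed
  then show "\<exists>F. finite F \<and> (\<forall>x. (\<forall>i\<in>F. coord x i = 0) \<longrightarrow> norm (S (tensor_vec (unit_vec k) x)) \<le> e * norm x)"
    using F(1) by (intro exI[of _ "snd ` F"]) simp
qed

section \<open>Invariant vectors of the tensor square\<close>

lemma unitary_rep_bounded:
  assumes "unitary_rep G UNIV \<pi>" "g \<in> carrier G"
  shows "norm (\<pi> g x) = norm x" "bounded_linear (\<pi> g)"
proof -
  show n: "norm (\<pi> g x) = norm x" for x
    using assms by (simp add: unitary_rep_def norm_ell2_def inner_ell2_def)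
  show "bounded_linear (\<pi> g)"
    by (rule bounded_linear_intro[where K = 1])
      (use assms n in \<open>simp_all add: unitary_rep_def scaleR_scaleC\<close>)
qed

lemma norm_univ_rep_le:
  fixes G :: "('g, 'm) monoid_scheme"
  assumes "g \<in> carrier G"
  shows "norm (univ_rep G g x) \<le> norm x"
proof -
  have "norm (\<pi> g y) = norm y" "bounded_linear (\<pi> g)" if "unitary_rep G UNIV \<pi>"
    for \<pi> :: "'g \<Rightarrow> nat ell2 \<Rightarrow> nat ell2" and y
    using unitary_rep_bounded[OF that assms] by auto
  then have "norm (univ_rep G g x) \<le> 1 * norm x"
    unfolding univ_rep_def by (intro norm_direct_sum_op) (auto simp: id_def bounded_linear_ident)
  then show ?thesis by simp
qed

text \<open>
  The vectors \<open>tensor_vec (unit_vec k) x\<close> form the summand of the universal representation that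
  belongs to \<open>k\<close>.
\<close>

lemma univ_rep_embed:
  assumes "g \<in> carrier G"
  shows "univ_rep G g (tensor_vec (unit_vec k) x) =
    tensor_vec (unit_vec k) ((if unitary_rep G UNIV k then k g else id) x)"
proof -
  let ?F = "\<lambda>l. if unitary_rep G UNIV l then l g else id"
  have z: "?F l 0 = 0" for l
    using linear_0[OF bounded_linear.linear[OF unitary_rep_bounded(2)], of G l g] assms by simp
  have "slice (univ_rep G g (tensor_vec (unit_vec k) x)) l = slice (tensor_vec (unit_vec k) (?F k x)) l" for l
    unfolding slice_univ_rep[OF assms] slice_tensor_vec coord_unit_vec
    using z[of l] by (auto simp: scaleC_one)
  then show ?thesis
    by (intro ell2_eqI) (metis coord_slice surj_pair)
qed

text \<open>
  The heart of the argument: a vector that is invariant under the diagonal action on the tensor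
  square of the universal representation is unchanged by the projection \<open>p\<close> onto the invariant
  vectors of one leg. Otherwise the Hilbert-Schmidt map given by the component of \<open>Y\<close> on which this
  projection vanishes is nonzero on some summand \<open>k\<close>. It intertwines the action, so that its
  maximizing vectors form a finite-dimensional invariant subspace of that summand, which contains
  a nonzero fixed vector. But a fixed vector is fixed by \<open>p\<close> and therefore sent to \<open>0\<close>.
\<close>

lemma invariant_tensor_absorbs_projection:
  fixes G :: "('g, 'm) monoid_scheme" and p :: "'g univ_index operator"
  assumes G: "group G" and only: "only_trivial_fd_irreps G"
    and self_adjoint: "\<And>x y. cinner (p x) y = cinner x (p y)"
    and commute: "\<And>g x. g \<in> carrier G \<Longrightarrow> p (univ_rep G g x) = univ_rep G g (p x)"
    and fixed: "\<And>x. (\<And>g. g \<in> carrier G \<Longrightarrow> univ_rep G g x = x) \<Longrightarrow> p x = x"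
    and Y: "\<And>g x z. g \<in> carrier G \<Longrightarrow>
      cinner (tensor_vec (univ_rep G g x) (univ_rep G g z)) Y = cinner (tensor_vec x z) Y"
  shows "cinner (tensor_vec x (p z)) Y = cinner (tensor_vec x z) Y"
proof -
  define W where "W = direct_sum_op (\<lambda>_ x. x - p x) Y"
  have slice_W: "slice W j = slice Y j - p (slice Y j)" for j
    unfolding W_def
  proof (rule slice_direct_sum_op[where B = "1 + norm p"])
    show "bounded_linear (\<lambda>x. x - p x)"
      by (intro bounded_linear_sub bounded_linear_ident blinfun.bounded_linear_right)
    show "norm (x - p x) \<le> (1 + norm p) * norm x" for x
      using norm_triangle_ineq4[of x "p x"] norm_blinfun[of p x] by (simp add: algebra_simps)
  qed simp
  have contract_W: "contract W z = contract Y (z - p z)" for z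
    by (rule ell2_eqI)
      (simp add: coord_contract slice_W cinner_diff_left cinner_diff_right self_adjoint)
  \<comment> \<open>The map \<open>contract W\<close> intertwines the action up to antilinear duality, and \<open>u g\<close> is a contraction.\<close>
  have contract_grow: "norm (contract W z) \<le> norm (contract W (univ_rep G g z))"
    if g: "g \<in> carrier G" for g z
  proof -
    let ?s = "contract W z"
    let ?u = "univ_rep G g"
    have eq: "?u (z - p z) = ?u z - p (?u z)"
      by (simp add: blinfun.diff_right commute[OF g])
    have "cinner ?s ?s = cinner (tensor_vec ?s (z - p z)) Y"
      by (simp flip: cinner_contract contract_W)
    also have "\<dots> = cinner (tensor_vec (?u ?s) (?u z - p (?u z))) Y"
      using Y[OF g, of ?s "z - p z"] by (simp only: eq)
    also have "\<dots> = cinner (?u ?s) (contract W (?u z))"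
      by (simp add: cinner_contract contract_W)
    finally have "inner ?s ?s = inner (?u ?s) (contract W (?u z))"
      by (simp add: inner_ell2_def)
    then have "norm ?s * norm ?s = inner (?u ?s) (contract W (?u z))"
      by (metis power2_eq_square power2_norm_eq_inner)
    also have "\<dots> \<le> norm (?u ?s) * norm (contract W (?u z))"
      by (rule norm_cauchy_schwarz)
    also have "\<dots> \<le> norm ?s * norm (contract W (?u z))"
      by (intro mult_right_mono norm_univ_rep_le g) simp
    finally show ?thesis
      by (cases "norm ?s = 0") (simp, metis mult_le_cancel_left_pos norm_ge_zero order_le_less)
  qed
  have zero: "contract W (tensor_vec (unit_vec k) x) = 0" for k x
  proof (cases "unitary_rep G UNIV k")
    case False
    then have "univ_rep G g (tensor_vec (unit_vec k) x) = tensor_vec (unit_vec k) x"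
      if "g \<in> carrier G" for g
      by (simp add: univ_rep_embed[OF that])
    then have "p (tensor_vec (unit_vec k) x) = tensor_vec (unit_vec k) x" by (rule fixed)
    then show ?thesis
      by (simp add: contract_W contract_zero)
  next
    case rep: True
    define S where "S x = contract W (tensor_vec (unit_vec k) x)" for x
    have S: "compact_antilinear S"
      unfolding S_def by (intro compact_antilinear_embed compact_antilinear_contract)
    obtain m where m: "\<And>x. norm (S x) \<le> m * norm x" "0 \<le> m" "\<exists>x. x \<noteq> 0 \<and> norm (S x) = m * norm x"
      by (rule compact_antilinear_attains_norm[OF S], rule that)
    have "m = 0"
    proof (rule ccontr)
      assume "m \<noteq> 0"
      with m(2) have pos: "0 < m" by simp
      define M where "M = {x. norm (S x) = m * norm x}"
      note M = compact_antilinear_maximizers[OF S m(1) pos, folded M_def]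
      have inv: "k g ` M \<subseteq> M" if g: "g \<in> carrier G" for g
      proof
        fix y assume "y \<in> k g ` M"
        then obtain x where x: "x \<in> M" "y = k g x" by blast
        have "m * norm y = norm (S x)"
          using x by (simp add: M_def unitary_rep_bounded(1)[OF rep g])
        also have "\<dots> \<le> norm (S y)"
          using contract_grow[OF g, of "tensor_vec (unit_vec k) x"] rep
          by (simp add: S_def univ_rep_embed[OF g] x(2))
        finally show "y \<in> M" using m(1)[of y] by (simp add: M_def)
      qed
      have "M \<noteq> {0}" using m(3) by (auto simp: M_def)
      then obtain v where v: "v \<in> M" "v \<noteq> 0" "\<And>g. g \<in> carrier G \<Longrightarrow> k g v = v"
        using finite_dimensional_invariant_fixed_vector[OF G only rep M(1,2,3)] inv by blast
      have "p (tensor_vec (unit_vec k) v) = tensor_vec (unit_vec k) v"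
        by (rule fixed) (simp add: univ_rep_embed v(3))
      then have "S v = 0"
        by (simp add: S_def contract_W contract_zero)
      then show False using v(1,2) pos by (simp add: M_def)
    qed
    then show ?thesis using m(1)[of x] by (simp add: S_def)
  qed
  have "slice W j = 0" for j
  proof (rule ell2_eqI)
    fix i :: "'g univ_index"
    obtain k n where i: "i = (k, n)" by (cases i)
    have "unit_vec i = tensor_vec (unit_vec k) (unit_vec n)"
      using tensor_unit_vec[of 1 k n] by (simp add: scaleC_one i)
    then have "coord (slice W j) i = coord (contract W (tensor_vec (unit_vec k) (unit_vec n))) j"
      by (metis coord_contract cinner_unit_vec)
    then show "coord (slice W j) i = coord 0 i"
      by (simp add: zero zero_ell2.rep_eq)
  qed
  then have "contract W z = 0"
    by (intro ell2_eqI) (simp add: coord_contract zero_ell2.rep_eq)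
  moreover have "contract Y (z - p z) + contract Y (p z) = contract Y z"
    by (simp flip: contract_add)
  ultimately have "contract Y (p z) = contract Y z" by (simp add: contract_W)
  then show ?thesis by (metis cinner_contract)
qed

section \<open>The full group C*-algebra and its multiplicative functionals\<close>

lemma bounded_linear_scaleC: "bounded_linear (\<lambda>x :: 'a::complex_normed_vector. c *\<^sub>C x)"
  using bounded_linear_scaleC_comp[of "blinfun_apply id_blinfun" c] by (simp add: blinfun.bounded_linear_right)

lemma blinfun_apply_scaleC: "blinfun_apply (c *\<^sub>C a) x = c *\<^sub>C blinfun_apply a x"
  by (simp add: scaleC_blinfun.rep_eq)

lemma tendsto_blinfun_apply: "(a \<longlongrightarrow> b) F \<Longrightarrow> ((\<lambda>n. blinfun_apply (a n) x) \<longlongrightarrow> blinfun_apply b x) F"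
  by (rule bounded_linear.tendsto[OF blinfun.bounded_linear_left])

lemma complex_linear_closure:
  assumes "\<And>a. a \<in> A \<Longrightarrow> complex_linear a" "b \<in> closure A"
  shows "complex_linear b"
proof -
  have "closed {a :: 'a \<Rightarrow>\<^sub>L 'b. complex_linear a}"
    unfolding complex_linear_def
    by (intro closed_Collect_all closed_Collect_eq)
      (auto intro!: bounded_linear.continuous_on[OF blinfun.bounded_linear_left]
        bounded_linear.continuous_on[OF bounded_linear_scaleC] continuous_on_id)
  then have "closure A \<subseteq> {a. complex_linear a}"
    using assms(1) by (intro closure_minimal) auto
  with assms(2) show ?thesis by blast
qed

lemma complex_linear_span:
  assumes "\<And>a. a \<in> A \<Longrightarrow> complex_linear a" "b \<in> complex_vector.span A"
  shows "complex_linear b"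
  using assms(2)
proof (induction rule: complex_vector.span_induct_alt)
  case base
  then show ?case by (simp add: complex_linear_def)
next
  case (step c x y)
  then show ?case
    using assms(1)[of x]
    by (simp add: complex_linear_def blinfun.add_left blinfun_apply_scaleC scaleC_add_right
        scaleC_scaleC mult.commute)
qed

lemma complex_linear_univ_rep:
  fixes G :: "('g, 'm) monoid_scheme"
  assumes g: "g \<in> carrier G"
  shows "complex_linear (univ_rep G g)"
  unfolding complex_linear_def
proof (intro allI slice_eqI)
  show "slice (univ_rep G g (c *\<^sub>C x)) k = slice (c *\<^sub>C univ_rep G g x) k" for c x k
    using g by (simp add: slice_univ_rep slice_scaleC unitary_rep_def)
qed

lemma complex_linear_full_cstar: "a \<in> full_cstar G \<Longrightarrow> complex_linear a"
  unfolding full_cstar_def group_algebra_def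
  by (erule complex_linear_closure[rotated], erule complex_linear_span[rotated])
    (auto simp: complex_linear_univ_rep)

lemma complex_linear_tensor_op:
  assumes "complex_linear a" "complex_linear b"
  shows "complex_linear (tensor_op a b)"
  unfolding complex_linear_def
proof (intro allI)
  fix c and x :: "('a \<times> 'b) ell2"
  show "tensor_op a b (c *\<^sub>C x) = c *\<^sub>C tensor_op a b x"
  proof (rule bounded_linear_ell2_eqI[where x = x])
    show "bounded_linear (\<lambda>x. tensor_op a b (c *\<^sub>C x))"
      by (rule bounded_linear_compose[OF blinfun.bounded_linear_right bounded_linear_scaleC])
    show "bounded_linear (\<lambda>x. c *\<^sub>C tensor_op a b x)"
      by (rule bounded_linear_compose[OF bounded_linear_scaleC blinfun.bounded_linear_right])
    fix d and q :: "'a \<times> 'b"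
    show "tensor_op a b (c *\<^sub>C d *\<^sub>C unit_vec q) = c *\<^sub>C tensor_op a b (d *\<^sub>C unit_vec q)"
      using assms(1)
      by (cases q) (simp add: tensor_unit_vec tensor_op_apply[OF assms]
          complex_linear_def flip: tensor_vec_scaleC_left)
  qed
qed

lemma complex_linear_spatial_tensor:
  "b \<in> spatial_tensor (full_cstar G) (full_cstar G) \<Longrightarrow> complex_linear b"
  unfolding spatial_tensor_def alg_tensor_def
  by (erule complex_linear_closure[rotated], erule complex_linear_span[rotated])
    (auto simp: complex_linear_tensor_op complex_linear_full_cstar)

lemma univ_rep_mult:
  assumes "group G" "g \<in> carrier G" "h \<in> carrier G"
  shows "univ_rep G g o\<^sub>L univ_rep G h = univ_rep G (g \<otimes>\<^bsub>G\<^esub> h)"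
proof -
  interpret group G by fact
  show ?thesis
    by (intro blinfun_eqI slice_eqI)
      (use assms in \<open>simp add: slice_univ_rep unitary_rep_def\<close>)
qed

lemma compose_scaleC_left: "(c *\<^sub>C a) o\<^sub>L b = c *\<^sub>C (a o\<^sub>L b)"
  by (rule blinfun_eqI) (simp add: blinfun_apply_scaleC)

lemma compose_scaleC_right: "complex_linear a \<Longrightarrow> a o\<^sub>L (c *\<^sub>C b) = c *\<^sub>C (a o\<^sub>L b)"
  by (rule blinfun_eqI) (simp add: blinfun_apply_scaleC complex_linear_def)

lemma compose_add_left: "(a + b) o\<^sub>L c = (a o\<^sub>L c) + (b o\<^sub>L c)"
  by (rule blinfun_eqI) (simp add: blinfun.add_left)

lemma compose_add_right: "a o\<^sub>L (b + c) = (a o\<^sub>L b) + (a o\<^sub>L c)"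
  by (rule blinfun_eqI) (simp add: blinfun.add_left blinfun.add_right)

lemma compose_diff_right: "a o\<^sub>L (b - c) = (a o\<^sub>L b) - (a o\<^sub>L c)"
  by (rule blinfun_eqI) (simp add: blinfun.diff_left blinfun.diff_right)

lemma group_algebra_compose:
  assumes G: "group G" and a: "a \<in> group_algebra G" and b: "b \<in> group_algebra G"
  shows "a o\<^sub>L b \<in> group_algebra G"
proof -
  interpret group G by fact
  have 1: "univ_rep G g o\<^sub>L b \<in> group_algebra G" if g: "g \<in> carrier G" for g
    using b unfolding group_algebra_def
  proof (induction rule: complex_vector.span_induct_alt)
    case base
    have "univ_rep G g o\<^sub>L 0 = 0" by (rule blinfun_eqI) simp
    then show ?case by (simp add: complex_vector.span_zero)
  next
    case (step c x y)
    then show ?case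
      using g by (auto simp: compose_add_right compose_scaleC_right complex_linear_univ_rep univ_rep_mult[OF G]
          intro!: complex_vector.span_add complex_vector.span_scale intro: complex_vector.span_base)
  qed
  show ?thesis
    using a unfolding group_algebra_def
  proof (induction rule: complex_vector.span_induct_alt)
    case base
    have "0 o\<^sub>L b = 0" by (rule blinfun_eqI) simp
    then show ?case by (simp add: complex_vector.span_zero)
  next
    case (step c x y)
    then show ?case
      using 1 by (auto simp: compose_add_left compose_scaleC_left group_algebra_def
          intro!: complex_vector.span_add complex_vector.span_scale)
  qed
qed

lemma group_algebra_subset_full_cstar: "group_algebra G \<subseteq> full_cstar G"
  by (simp add: full_cstar_def closure_subset)

lemma univ_rep_in_full_cstar: "g \<in> carrier G \<Longrightarrow> univ_rep G g \<in> full_cstar G"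
  using group_algebra_subset_full_cstar[of G]
  by (auto simp: group_algebra_def intro: complex_vector.span_base)

lemma full_cstar_approx:
  assumes "a \<in> full_cstar G"
  obtains s where "\<And>n. s n \<in> group_algebra G" "s \<longlonglongrightarrow> a"
  using assms unfolding full_cstar_def closure_sequential by blast

lemma full_cstar_limit:
  assumes "\<And>n. s n \<in> group_algebra G" "s \<longlonglongrightarrow> a"
  shows "a \<in> full_cstar G"
  using assms unfolding full_cstar_def closure_sequential by blast

lemma full_cstar_subspace: "complex_vector.subspace (full_cstar G)"
proof (rule complex_vector.subspaceI)
  show "0 \<in> full_cstar G"
    using group_algebra_subset_full_cstar[of G] by (auto simp: group_algebra_def complex_vector.span_zero)
  fix a b assume "a \<in> full_cstar G" "b \<in> full_cstar G"
  then obtain s t where "\<And>n. s n \<in> group_algebra G" "s \<longlonglongrightarrow> a" "\<And>n. t n \<in> group_algebra G" "t \<longlonglongrightarrow> b"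
    using full_cstar_approx by metis
  then show "a + b \<in> full_cstar G"
    by (intro full_cstar_limit[of "\<lambda>n. s n + t n"] tendsto_add)
      (auto simp: group_algebra_def complex_vector.span_add)
next
  fix c a assume "a \<in> full_cstar G"
  then obtain s where "\<And>n. s n \<in> group_algebra G" "s \<longlonglongrightarrow> a"
    using full_cstar_approx by metis
  then show "c *\<^sub>C a \<in> full_cstar G"
    by (intro full_cstar_limit[of "\<lambda>n. c *\<^sub>C s n"] bounded_linear.tendsto[OF bounded_linear_scaleC])
      (auto simp: group_algebra_def complex_vector.span_scale)
qed

lemma full_cstar_compose:
  assumes "group G" "a \<in> full_cstar G" "b \<in> full_cstar G"
  shows "a o\<^sub>L b \<in> full_cstar G"
proof -
  obtain s t where "\<And>n. s n \<in> group_algebra G" "s \<longlonglongrightarrow> a" "\<And>n. t n \<in> group_algebra G" "t \<longlonglongrightarrow> b"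
    using full_cstar_approx assms(2,3) by metis
  then show ?thesis
    by (intro full_cstar_limit[of "\<lambda>n. s n o\<^sub>L t n"] group_algebra_compose assms(1)
        bounded_bilinear.tendsto[OF bounded_bilinear_blinfun_compose])
qed

definition multiplicative_functional :: "'i operator set \<Rightarrow> ('i operator \<Rightarrow> complex) \<Rightarrow> bool" where
  "multiplicative_functional A \<phi> \<longleftrightarrow> (\<forall>a\<in>A. \<forall>c. \<phi> (c *\<^sub>C a) = c * \<phi> a) \<and>
     (\<forall>a\<in>A. \<forall>b\<in>A. \<phi> (a + b) = \<phi> a + \<phi> b \<and> \<phi> (a o\<^sub>L b) = \<phi> a * \<phi> b)"

lemma multiplicative_functionalD:
  assumes "multiplicative_functional A \<phi>"
  shows "a \<in> A \<Longrightarrow> \<phi> (c *\<^sub>C a) = c * \<phi> a"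
    and "a \<in> A \<Longrightarrow> b \<in> A \<Longrightarrow> \<phi> (a + b) = \<phi> a + \<phi> b"
    and "a \<in> A \<Longrightarrow> b \<in> A \<Longrightarrow> \<phi> (a o\<^sub>L b) = \<phi> a * \<phi> b"
  using assms by (simp_all add: multiplicative_functional_def)

text \<open>
  The automatic continuity of characters: if \<open>b\<close> has norm less than \<open>1\<close>, then \<open>c = b + b c\<close> has a
  solution in the algebra, and \<open>\<phi> b = 1\<close> would give \<open>\<phi> c = 1 + \<phi> c\<close>.
\<close>

lemma multiplicative_functional_norm_le:
  assumes A: "closed A" "complex_vector.subspace A" "\<And>a b. a \<in> A \<Longrightarrow> b \<in> A \<Longrightarrow> a o\<^sub>L b \<in> A"
    and \<phi>: "multiplicative_functional A \<phi>" and a: "a \<in> A"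
  shows "cmod (\<phi> a) \<le> norm a"
proof (rule ccontr)
  assume "\<not> ?thesis"
  then have less: "norm a < cmod (\<phi> a)" by simp
  then have nz: "\<phi> a \<noteq> 0" using norm_ge_zero[of a] by force
  define b where "b = (1 / \<phi> a) *\<^sub>C a"
  have b: "b \<in> A" using a A(2) by (simp add: b_def complex_vector.subspace_scale)
  have nb: "norm b < 1" using less nz by (simp add: b_def norm_scaleC norm_divide)
  have \<phi>b: "\<phi> b = 1" using \<phi> a nz by (simp add: b_def multiplicative_functional_def)
  have "\<exists>!c\<in>A. b + (b o\<^sub>L c) = c"
  proof (rule Banach_fix[where c = "norm b"])
    show "complete A" using A(1) by (simp add: complete_eq_closed)
    show "(\<lambda>c. b + (b o\<^sub>L c)) ` A \<subseteq> A"
      using A b by (auto intro!: complex_vector.subspace_add)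
    show "dist (b + (b o\<^sub>L x)) (b + (b o\<^sub>L y)) \<le> norm b * dist x y" for x y
      using norm_blinfun_compose[of b "x - y"] by (simp add: dist_norm compose_diff_right)
  qed (use b nb in auto)
  then obtain c where c: "c \<in> A" "b + (b o\<^sub>L c) = c" by blast
  have "\<phi> c = \<phi> (b + (b o\<^sub>L c))" by (simp only: c(2))
  also have "\<dots> = 1 + \<phi> c"
    using \<phi> b c(1) A(3) \<phi>b by (simp add: multiplicative_functional_def)
  finally show False by simp
qed

text \<open>
  This carries statements about the group algebra over to its closure.
\<close>

lemma multiplicative_functional_tendsto:
  assumes G: "group G" and \<phi>: "multiplicative_functional (full_cstar G) \<phi>"
    and s: "\<And>n. s n \<in> group_algebra G" "s \<longlonglongrightarrow> a"
  shows "(\<lambda>n. \<phi> (s n)) \<longlonglongrightarrow> \<phi> a"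
proof -
  have sA: "s n \<in> full_cstar G" "a \<in> full_cstar G" for n
    using s group_algebra_subset_full_cstar full_cstar_limit by blast+
  have diff: "s n - a \<in> full_cstar G" for n
    using sA full_cstar_subspace complex_vector.subspace_diff by blast
  have "\<phi> (s n) - \<phi> a = \<phi> (s n - a)" for n
  proof -
    have "\<phi> ((s n - a) + a) = \<phi> (s n - a) + \<phi> a"
      using \<phi> diff sA unfolding multiplicative_functional_def by blast
    then show ?thesis by simp
  qed
  then have "cmod (\<phi> (s n) - \<phi> a) \<le> norm (s n - a)" for n
    using multiplicative_functional_norm_le[OF _ full_cstar_subspace full_cstar_compose[OF G] \<phi> diff]
    by (simp add: full_cstar_def)
  moreover have "(\<lambda>n. norm (s n - a)) \<longlonglongrightarrow> 0"
    using s(2) by (simp add: LIM_zero tendsto_norm_zero)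
  ultimately have "(\<lambda>n. \<phi> (s n) - \<phi> a) \<longlonglongrightarrow> 0"
    by (intro Lim_null_comparison[of "\<lambda>n. \<phi> (s n) - \<phi> a" "\<lambda>n. norm (s n - a)"] always_eventually) auto
  then show ?thesis by (rule LIM_zero_cancel)
qed

lemma multiplicative_functional_eqI:
  assumes G: "group G"
    and \<phi>: "multiplicative_functional (full_cstar G) \<phi>" and \<psi>: "multiplicative_functional (full_cstar G) \<psi>"
    and eq: "\<And>g. g \<in> carrier G \<Longrightarrow> \<phi> (univ_rep G g) = \<psi> (univ_rep G g)"
    and a: "a \<in> full_cstar G"
  shows "\<phi> a = \<psi> a"
proof -
  note sub = full_cstar_subspace[of G]
  have "complex_vector.subspace {a \<in> full_cstar G. \<phi> a = \<psi> a}"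
  proof (rule complex_vector.subspaceI)
    have "\<phi> (0 *\<^sub>C 0) = 0" "\<psi> (0 *\<^sub>C 0) = 0"
      using \<phi> \<psi> complex_vector.subspace_0[OF sub] unfolding multiplicative_functional_def by (metis mult_zero_left)+
    then show "0 \<in> {a \<in> full_cstar G. \<phi> a = \<psi> a}"
      using complex_vector.subspace_0[OF sub] by simp
  qed (use \<phi> \<psi> complex_vector.subspace_add[OF sub] complex_vector.subspace_scale[OF sub]
      in \<open>auto simp: multiplicative_functional_def\<close>)
  then have "group_algebra G \<subseteq> {a \<in> full_cstar G. \<phi> a = \<psi> a}"
    unfolding group_algebra_def
    by (intro complex_vector.span_minimal) (auto simp: eq univ_rep_in_full_cstar)
  then have ga: "\<phi> b = \<psi> b" if "b \<in> group_algebra G" for b using that by blast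
  obtain s where s: "\<And>n. s n \<in> group_algebra G" "s \<longlonglongrightarrow> a"
    using full_cstar_approx[OF a] by blast
  have "(\<lambda>n. \<phi> (s n)) \<longlonglongrightarrow> \<psi> a"
    using multiplicative_functional_tendsto[OF G \<psi> s] ga s(1) by simp
  then show ?thesis
    using multiplicative_functional_tendsto[OF G \<phi> s] LIMSEQ_unique by blast
qed

lemma full_cstar_fixed_vector:
  assumes G: "group G"
    and \<epsilon>: "multiplicative_functional (full_cstar G) \<epsilon>" "\<And>g. g \<in> carrier G \<Longrightarrow> \<epsilon> (univ_rep G g) = 1"
    and x: "\<And>g. g \<in> carrier G \<Longrightarrow> univ_rep G g x = x"
    and a: "a \<in> full_cstar G"
  shows "a x = \<epsilon> a *\<^sub>C x"
proof -
  have ga: "b x = \<epsilon> b *\<^sub>C x \<and> b \<in> full_cstar G" if "b \<in> group_algebra G" for b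
    using that unfolding group_algebra_def
  proof (induction rule: complex_vector.span_induct_alt)
    case base
    have 0: "0 \<in> full_cstar G" by (rule complex_vector.subspace_0[OF full_cstar_subspace])
    then have "\<epsilon> (0 *\<^sub>C 0) = 0" using \<epsilon>(1) unfolding multiplicative_functional_def by (metis mult_zero_left)
    with 0 show ?case by simp
  next
    case (step c b y)
    then obtain g where g: "g \<in> carrier G" "b = univ_rep G g" by blast
    have b: "b \<in> full_cstar G" unfolding g(2) by (rule univ_rep_in_full_cstar[OF g(1)])
    then have cb: "c *\<^sub>C b \<in> full_cstar G" by (rule complex_vector.subspace_scale[OF full_cstar_subspace])
    have y: "y x = \<epsilon> y *\<^sub>C x" "y \<in> full_cstar G" using step.IH by auto
    have "\<epsilon> (c *\<^sub>C b + y) = \<epsilon> (c *\<^sub>C b) + \<epsilon> y" "\<epsilon> (c *\<^sub>C b) = c * \<epsilon> b"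
      using multiplicative_functionalD(1,2)[OF \<epsilon>(1)] b cb y(2) by simp_all
    then have "\<epsilon> (c *\<^sub>C b + y) = c + \<epsilon> y" using \<epsilon>(2)[OF g(1)] g(2) by simp
    moreover have "c *\<^sub>C b + y \<in> full_cstar G"
      by (rule complex_vector.subspace_add[OF full_cstar_subspace cb y(2)])
    moreover have "(c *\<^sub>C b + y) x = (c + \<epsilon> y) *\<^sub>C x"
      using x[OF g(1)] g(2) y(1) by (simp add: blinfun.add_left blinfun_apply_scaleC scaleC_add_left)
    ultimately show ?case by simp
  qed
  obtain s where s: "\<And>n. s n \<in> group_algebra G" "s \<longlonglongrightarrow> a"
    using full_cstar_approx[OF a] by blast
  have bl: "bounded_linear (\<lambda>c. c *\<^sub>C x)"
    by (rule bounded_linear_intro[where K = "norm x"])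
      (simp_all add: scaleC_add_left norm_scaleC scaleR_scaleC scaleC_scaleC scaleR_conv_of_real)
  have "(\<lambda>n. s n x) \<longlonglongrightarrow> \<epsilon> a *\<^sub>C x"
    using bounded_linear.tendsto[OF bl multiplicative_functional_tendsto[OF G \<epsilon>(1) s]] ga s(1) by simp
  then show ?thesis using tendsto_blinfun_apply[OF s(2), of x] LIMSEQ_unique by blast
qed

section \<open>The regular representation\<close>

lemma coord_permute:
  assumes "inj \<tau>"
  shows "coord (Abs_ell2 (\<lambda>i. coord x (\<tau> i))) i = coord x (\<tau> i)"
proof -
  have "(\<Sum>i\<in>F. (cmod (coord x (\<tau> i)))\<^sup>2) \<le> (norm x)\<^sup>2" if "finite F" for F
    using finite_sum_coord_le[of "\<tau> ` F" x] that assms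
    by (simp add: sum.reindex inj_on_subset[OF assms])
  then show ?thesis using ell2I(1)[of "\<lambda>i. coord x (\<tau> i)" "norm x"] by simp
qed

text \<open>
  The left regular representation has to act on \<^typ>\<open>nat ell2\<close> to be a summand of the universal
  representation, so that the group is enumerated by the natural numbers.
\<close>

definition regular_action :: "('g, 'm) monoid_scheme \<Rightarrow> 'g \<Rightarrow> nat \<Rightarrow> nat" where
  "regular_action G g n = to_nat_on (carrier G) (inv\<^bsub>G\<^esub> g \<otimes>\<^bsub>G\<^esub> from_nat_into (carrier G) n)"

definition regular_rep :: "('g, 'm) monoid_scheme \<Rightarrow> 'g \<Rightarrow> nat ell2 \<Rightarrow> nat ell2" where
  "regular_rep G g x = Abs_ell2 (\<lambda>n. coord x (regular_action G g n))"

context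
  fixes G :: "('g, 'm) monoid_scheme"
  assumes G: "group G" and inf: "infinite (carrier G)" and cnt: "countable (carrier G)"
begin

interpretation group G by (rule G)

lemma from_nat_into_carrier: "from_nat_into (carrier G) n \<in> carrier G"
  using inf by (metis from_nat_into finite.emptyI)

lemma regular_action_mult:
  assumes "g \<in> carrier G" "h \<in> carrier G"
  shows "regular_action G (g \<otimes>\<^bsub>G\<^esub> h) n = regular_action G h (regular_action G g n)"
  using assms from_nat_into_carrier[of n] cnt
  by (simp add: regular_action_def inv_mult_group m_assoc)

lemma regular_action_one: "regular_action G \<one>\<^bsub>G\<^esub> n = n"
  using from_nat_into_carrier[of n] cnt inf by (simp add: regular_action_def to_nat_on_from_nat_into_infinite)

lemma regular_action_bij:
  assumes g: "g \<in> carrier G" shows "bij (regular_action G g)"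
proof (rule o_bij)
  show "regular_action G (inv\<^bsub>G\<^esub> g) \<circ> regular_action G g = id"
    using g by (auto simp: fun_eq_iff regular_action_one simp flip: regular_action_mult)
  show "regular_action G g \<circ> regular_action G (inv\<^bsub>G\<^esub> g) = id"
    using g by (auto simp: fun_eq_iff regular_action_one simp flip: regular_action_mult)
qed

lemma regular_action_transitive: "\<exists>g\<in>carrier G. regular_action G g n = m"
proof
  let ?e = "from_nat_into (carrier G)"
  let ?g = "inv\<^bsub>G\<^esub> (?e m \<otimes>\<^bsub>G\<^esub> inv\<^bsub>G\<^esub> ?e n)"
  show "?g \<in> carrier G" by (simp add: from_nat_into_carrier)
  show "regular_action G ?g n = m"
    using from_nat_into_carrier[of n] from_nat_into_carrier[of m] cnt inf
    by (simp add: regular_action_def m_assoc to_nat_on_from_nat_into_infinite)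
qed

lemma coord_regular_rep:
  "g \<in> carrier G \<Longrightarrow> coord (regular_rep G g x) n = coord x (regular_action G g n)"
  unfolding regular_rep_def by (rule coord_permute) (simp add: regular_action_bij bij_is_inj)

lemma unitary_regular_rep: "unitary_rep G UNIV (regular_rep G)"
  unfolding unitary_rep_def
proof (intro conjI ballI allI)
  fix g assume g: "g \<in> carrier G"
  fix x y :: "nat ell2"
  show "regular_rep G g (x + y) = regular_rep G g x + regular_rep G g y"
    by (rule ell2_eqI) (simp add: coord_regular_rep[OF g] plus_ell2.rep_eq)
  show "cinner (regular_rep G g x) (regular_rep G g y) = cinner x y"
    unfolding cinner_def coord_regular_rep[OF g]
    by (rule infsum_reindex_bij_betw) (rule regular_action_bij[OF g])
  show "regular_rep G g (c *\<^sub>C x) = c *\<^sub>C regular_rep G g x" for c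
    by (rule ell2_eqI) (simp add: coord_regular_rep[OF g] coord_scaleC)
  show "regular_rep G (g \<otimes>\<^bsub>G\<^esub> h) x = regular_rep G g (regular_rep G h x)" if h: "h \<in> carrier G" for h
    by (rule ell2_eqI) (simp add: coord_regular_rep g h regular_action_mult)
next
  fix g assume g: "g \<in> carrier G"
  have "x = regular_rep G g (regular_rep G (inv\<^bsub>G\<^esub> g) x)" for x
    by (rule ell2_eqI)
      (simp add: coord_regular_rep g regular_action_one flip: regular_action_mult)
  then show "range (regular_rep G g) = UNIV" by (metis surjI)
qed simp_all

text \<open>
  In the regular representation an element of the group algebra sends the basis vector
  \<open>unit_vec 0\<close> to a finitely supported vector whose coordinates add up to its augmentation. If the
  element absorbs the group, this vector is invariant, hence constant because the action on
  coordinates is transitive, hence zero because there are infinitely many coordinates.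
\<close>

lemma group_algebra_invariant_augmentation:
  assumes \<epsilon>: "multiplicative_functional (full_cstar G) \<epsilon>" "\<And>g. g \<in> carrier G \<Longrightarrow> \<epsilon> (univ_rep G g) = 1"
    and p: "p \<in> group_algebra G" and inv: "\<And>g. g \<in> carrier G \<Longrightarrow> univ_rep G g o\<^sub>L p = p"
  shows "\<epsilon> p = 0"
proof -
  define e where "e = tensor_vec (unit_vec (regular_rep G)) (unit_vec (0 :: nat))"
  define v where "v a = slice (blinfun_apply a e) (regular_rep G)" for a :: "'g univ_index operator"
  have v_comp: "v (univ_rep G g o\<^sub>L a) = regular_rep G g (v a)" if "g \<in> carrier G" for g a
    using that by (simp add: v_def slice_univ_rep unitary_regular_rep)
  \<comment> \<open>Summing over all large initial segments lets finite supports be merged by taking maxima.\<close>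
  have ga: "b \<in> full_cstar G \<and> (\<exists>N. \<forall>M\<ge>N. coord (v b) M = 0 \<and> (\<Sum>n<M. coord (v b) n) = \<epsilon> b)"
    if "b \<in> group_algebra G" for b
    using that unfolding group_algebra_def
  proof (induction rule: complex_vector.span_induct_alt)
    case base
    have 0: "0 \<in> full_cstar G" by (rule complex_vector.subspace_0[OF full_cstar_subspace])
    then have "\<epsilon> 0 = 0"
      using multiplicative_functionalD(1)[OF \<epsilon>(1), of 0 0] by simp
    moreover have "coord (v 0) n = 0" for n by (simp add: v_def coord_slice zero_ell2.rep_eq)
    ultimately show ?case using 0 by simp
  next
    case (step c b y)
    then obtain g where g: "g \<in> carrier G" "b = univ_rep G g" by blast
    have b: "b \<in> full_cstar G" unfolding g(2) by (rule univ_rep_in_full_cstar[OF g(1)])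
    have cb: "c *\<^sub>C b \<in> full_cstar G" by (rule complex_vector.subspace_scale[OF full_cstar_subspace b])
    obtain N where y: "y \<in> full_cstar G" "\<And>M. N \<le> M \<Longrightarrow> coord (v y) M = 0"
      "\<And>M. N \<le> M \<Longrightarrow> (\<Sum>n<M. coord (v y) n) = \<epsilon> y"
      using step.IH by blast
    have \<epsilon>': "\<epsilon> (c *\<^sub>C b + y) = c + \<epsilon> y"
      using multiplicative_functionalD(1,2)[OF \<epsilon>(1)] b cb y(1) \<epsilon>(2)[OF g(1)] g(2) by simp
    obtain k where k: "regular_action G g k = 0"
      using regular_action_bij[OF g(1)] by (metis bij_pointE)
    then have k': "regular_action G g n = 0 \<longleftrightarrow> n = k" for n
      using regular_action_bij[OF g(1)] by (metis bij_pointE)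
    have "v b = regular_rep G g (unit_vec 0)"
      using g by (simp add: v_def slice_univ_rep unitary_regular_rep e_def slice_tensor_vec
          coord_unit_vec scaleC_one)
    then have vb: "coord (v b) n = (if n = k then 1 else 0)" for n
      using k' by (simp add: coord_regular_rep g(1) coord_unit_vec)
    have v_add: "coord (v (c *\<^sub>C b + y)) n = (if n = k then c else 0) + coord (v y) n" for n
    proof -
      have "v (c *\<^sub>C b + y) = c *\<^sub>C v b + v y"
        by (simp add: v_def blinfun.add_left blinfun_apply_scaleC slice_add slice_scaleC)
      then show ?thesis by (simp add: plus_ell2.rep_eq coord_scaleC vb)
    qed
    have "coord (v (c *\<^sub>C b + y)) M = 0 \<and> (\<Sum>n<M. coord (v (c *\<^sub>C b + y)) n) = \<epsilon> (c *\<^sub>C b + y)"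
      if "max N (Suc k) \<le> M" for M
      using that y(2,3)[of M] unfolding v_add \<epsilon>' sum.distrib by (simp add: sum.delta)
    moreover have "c *\<^sub>C b + y \<in> full_cstar G"
      by (rule complex_vector.subspace_add[OF full_cstar_subspace cb y(1)])
    ultimately show ?case by blast
  qed
  then obtain N where N: "\<And>M. N \<le> M \<Longrightarrow> coord (v p) M = 0"
    "\<And>M. N \<le> M \<Longrightarrow> (\<Sum>n<M. coord (v p) n) = \<epsilon> p"
    using p by blast
  have "coord (v p) n = 0" for n
  proof -
    obtain g where g: "g \<in> carrier G" "regular_action G g n = N"
      using regular_action_transitive by blast
    have "v p = regular_rep G g (v p)" using v_comp[OF g(1), of p] inv[OF g(1)] by simp
    then have "coord (v p) n = coord (v p) N" using coord_regular_rep[OF g(1)] g(2) by metis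
    then show ?thesis using N(1)[of N] by simp
  qed
  then show ?thesis using N(2)[of N] by simp
qed

end

section \<open>The image of the projection under the comultiplication\<close>

text \<open>
  Every operator in the spatial tensor product has \<open>tensor_vec x y\<close> as an eigenvector, because this
  holds for elementary tensors and is a closed condition. The eigenvalue of \<open>\<Delta> a\<close> is therefore a
  multiplicative functional of \<open>a\<close>, hence continuous in \<open>a\<close>, and it agrees with \<open>\<epsilon>\<close> on the
  group.
\<close>

lemma comultiplication_fixes_tensor:
  fixes G :: "('g, 'm) monoid_scheme"
  assumes G: "group G" and \<Delta>: "comultiplication G \<Delta>"
    and \<epsilon>: "multiplicative_functional (full_cstar G) \<epsilon>" "\<And>g. g \<in> carrier G \<Longrightarrow> \<epsilon> (univ_rep G g) = 1"
    and x: "\<And>g. g \<in> carrier G \<Longrightarrow> univ_rep G g x = x"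
    and y: "\<And>g. g \<in> carrier G \<Longrightarrow> univ_rep G g y = y"
    and a: "a \<in> full_cstar G"
  shows "\<Delta> a (tensor_vec x y) = \<epsilon> a *\<^sub>C tensor_vec x y"
proof (cases "tensor_vec x y = 0")
  case True
  then show ?thesis by simp
next
  case nz: False
  let ?A = "full_cstar G"
  define \<xi> where "\<xi> = tensor_vec x y"
  have hom: "star_hom ?A (spatial_tensor ?A ?A) \<Delta>"
    and \<Delta>u: "\<And>g. g \<in> carrier G \<Longrightarrow> \<Delta> (univ_rep G g) = tensor_op (univ_rep G g) (univ_rep G g)"
    using \<Delta> by (auto simp: comultiplication_def)
  have N: "cinner \<xi> \<xi> \<noteq> 0"
    using nz inner_eq_zero_iff[of \<xi>] by (auto simp: \<xi>_def inner_ell2_def)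
  let ?E = "{b. cinner \<xi> \<xi> *\<^sub>C blinfun_apply b \<xi> = cinner \<xi> (b \<xi>) *\<^sub>C \<xi>}"
  have "complex_vector.subspace ?E"
  proof (rule complex_vector.subspaceI)
    fix c b assume "b \<in> ?E"
    then have "c *\<^sub>C cinner \<xi> \<xi> *\<^sub>C blinfun_apply b \<xi> = c *\<^sub>C cinner \<xi> (b \<xi>) *\<^sub>C \<xi>" by simp
    then show "c *\<^sub>C b \<in> ?E"
      by (simp add: blinfun_apply_scaleC cinner_scaleC_right scaleC_scaleC mult.commute)
  qed (simp_all add: blinfun.add_left cinner_add_right scaleC_add_right scaleC_add_left)
  moreover have "tensor_op a b \<in> ?E" if "a \<in> ?A" "b \<in> ?A" for a b
  proof -
    have "tensor_op a b \<xi> = (\<epsilon> a * \<epsilon> b) *\<^sub>C \<xi>"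
      using that full_cstar_fixed_vector[OF G \<epsilon> x that(1)] full_cstar_fixed_vector[OF G \<epsilon> y that(2)]
      by (simp add: \<xi>_def tensor_op_apply complex_linear_full_cstar tensor_vec_scaleC_left
          tensor_vec_scaleC_right scaleC_scaleC)
    then show ?thesis by (simp add: cinner_scaleC_right scaleC_scaleC mult.commute)
  qed
  ultimately have "alg_tensor ?A ?A \<subseteq> ?E"
    unfolding alg_tensor_def by (intro complex_vector.span_minimal) auto
  moreover have "closed ?E"
  proof (intro closed_Collect_eq)
    have bl: "bounded_linear (\<lambda>b :: ('g univ_index \<times> 'g univ_index) operator. b \<xi>)"
      by (rule blinfun.bounded_linear_left)
    show "continuous_on UNIV (\<lambda>b :: ('g univ_index \<times> 'g univ_index) operator. cinner \<xi> \<xi> *\<^sub>C b \<xi>)"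
      by (rule bounded_linear.continuous_on[OF bounded_linear_scaleC])
        (rule bounded_linear.continuous_on[OF bl continuous_on_id])
    have le: "cmod (cinner \<xi> w) * norm \<xi> \<le> norm w * (norm \<xi> * norm \<xi>)" for w
      using mult_right_mono[OF cmod_cinner_le[of \<xi> w] norm_ge_zero[of \<xi>]] by (simp add: mult_ac)
    have "bounded_linear (\<lambda>w. cinner \<xi> w *\<^sub>C \<xi>)"
      by (rule bounded_linear_intro[where K = "norm \<xi> * norm \<xi>"])
        (simp_all add: cinner_add_right scaleC_add_left scaleR_scaleC cinner_scaleC_right
          scaleC_scaleC norm_scaleC le)
    from bounded_linear.continuous_on[OF this bounded_linear.continuous_on[OF bl continuous_on_id]]
    show "continuous_on UNIV (\<lambda>b :: ('g univ_index \<times> 'g univ_index) operator. cinner \<xi> (b \<xi>) *\<^sub>C \<xi>)" .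
  qed
  ultimately have E: "spatial_tensor ?A ?A \<subseteq> ?E"
    unfolding spatial_tensor_def by (rule closure_minimal)
  define \<phi> where "\<phi> a = cinner \<xi> (\<Delta> a \<xi>) / cinner \<xi> \<xi>" for a
  have \<phi>: "\<Delta> a \<xi> = \<phi> a *\<^sub>C \<xi>" if "a \<in> ?A" for a
  proof -
    have "cinner \<xi> \<xi> *\<^sub>C \<Delta> a \<xi> = cinner \<xi> (\<Delta> a \<xi>) *\<^sub>C \<xi>"
      using E hom that unfolding star_hom_def by blast
    then have "(1 / cinner \<xi> \<xi>) *\<^sub>C cinner \<xi> \<xi> *\<^sub>C \<Delta> a \<xi> = \<phi> a *\<^sub>C \<xi>"
      by (simp add: scaleC_scaleC \<phi>_def)
    then show ?thesis using N by (simp add: scaleC_scaleC scaleC_one)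
  qed
  have \<phi>I: "\<phi> a = c" if "\<Delta> a \<xi> = c *\<^sub>C \<xi>" for a c
    using that N by (simp add: \<phi>_def cinner_scaleC_right)
  have "multiplicative_functional ?A \<phi>"
    unfolding multiplicative_functional_def
  proof (intro conjI ballI allI)
    fix a assume a: "a \<in> ?A"
    show "\<phi> (c *\<^sub>C a) = c * \<phi> a" for c
      using hom a \<phi>[OF a] by (intro \<phi>I) (simp add: star_hom_def blinfun_apply_scaleC scaleC_scaleC)
    fix b assume b: "b \<in> ?A"
    show "\<phi> (a + b) = \<phi> a + \<phi> b"
      using hom a b \<phi>[OF a] \<phi>[OF b]
      by (intro \<phi>I) (simp add: star_hom_def blinfun.add_left scaleC_add_left)
    have "complex_linear (\<Delta> a)"
      by (rule complex_linear_spatial_tensor[where G = G]) (use hom a in \<open>simp add: star_hom_def\<close>)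
    then show "\<phi> (a o\<^sub>L b) = \<phi> a * \<phi> b"
      using hom a b \<phi>[OF a] \<phi>[OF b]
      by (intro \<phi>I) (simp add: star_hom_def complex_linear_def scaleC_scaleC mult.commute)
  qed
  moreover have "\<phi> (univ_rep G g) = \<epsilon> (univ_rep G g)" if g: "g \<in> carrier G" for g
    by (rule \<phi>I) (simp add: \<Delta>u g \<xi>_def tensor_op_apply complex_linear_univ_rep x y \<epsilon>(2) scaleC_one)
  ultimately have "\<phi> a = \<epsilon> a"
    using multiplicative_functional_eqI[OF G _ \<epsilon>(1) _ a] by blast
  then show ?thesis using \<phi>[OF a] by (simp add: \<xi>_def)
qed

theorem mainTheorem7:
  fixes \<Gamma> :: "('g, 'm) monoid_scheme"
    and \<epsilon> :: "'g univ_index operator \<Rightarrow> complex"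
    and \<Delta> :: "'g univ_index operator \<Rightarrow> ('g univ_index \<times> 'g univ_index) operator"
    and p :: "'g univ_index operator"
  assumes "group \<Gamma>" and "infinite (carrier \<Gamma>)" and "countable (carrier \<Gamma>)"
    and "property_T \<Gamma>"
    and "only_trivial_fd_irreps \<Gamma>"
    and "trivial_character \<Gamma> \<epsilon>"
    and "comultiplication \<Gamma> \<Delta>"
    and "minimal_projection (full_cstar \<Gamma>) p" and "central_in (full_cstar \<Gamma>) p" and "\<epsilon> p = 1"
  shows "\<Delta> p \<in> alg_tensor (full_cstar \<Gamma>) (full_cstar \<Gamma>) \<and> p \<notin> group_algebra \<Gamma>"
proof
  let ?A = "full_cstar \<Gamma>"
  let ?u = "univ_rep \<Gamma>"
  note G = assms(1)
  have \<epsilon>: "multiplicative_functional ?A \<epsilon>" and \<epsilon>u: "\<And>g. g \<in> carrier \<Gamma> \<Longrightarrow> \<epsilon> (?u g) = 1"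
    using assms(6) by (auto simp: trivial_character_def character_def multiplicative_functional_def)
  have p: "p \<in> ?A" "p o\<^sub>L p = p" "adj p = p"
    and p_min: "\<And>a. a \<in> ?A \<Longrightarrow> \<exists>c. p o\<^sub>L a o\<^sub>L p = c *\<^sub>C p"
    using assms(8) unfolding minimal_projection_def by blast+
  have p_central: "\<And>a. a \<in> ?A \<Longrightarrow> a o\<^sub>L p = p o\<^sub>L a"
    using assms(9) by (simp add: central_in_def)
  have u: "?u g \<in> ?A" if "g \<in> carrier \<Gamma>" for g
    using that by (rule univ_rep_in_full_cstar)
  \<comment> \<open>Minimality makes \<open>u p\<close> a multiple of \<open>p\<close>, and \<open>\<epsilon>\<close> shows that the factor is \<open>1\<close>.\<close>
  have up: "?u g o\<^sub>L p = p" if g: "g \<in> carrier \<Gamma>" for g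
  proof -
    obtain c where "p o\<^sub>L ?u g o\<^sub>L p = c *\<^sub>C p" using p_min[OF u[OF g]] by blast
    moreover have "p o\<^sub>L ?u g o\<^sub>L p = ?u g o\<^sub>L (p o\<^sub>L p)"
      unfolding p_central[OF u[OF g], symmetric] by (rule blinfun_eqI) simp
    ultimately have c: "?u g o\<^sub>L p = c *\<^sub>C p" by (simp add: p(2))
    have "\<epsilon> (?u g o\<^sub>L p) = 1"
      using multiplicative_functionalD(3)[OF \<epsilon> u[OF g] p(1)] \<epsilon>u[OF g] assms(10) by simp
    then have "c = 1"
      using c multiplicative_functionalD(1)[OF \<epsilon> p(1)] assms(10) by simp
    then show ?thesis using c by (simp add: scaleC_one)
  qed
  have up': "?u g (p x) = p x" if "g \<in> carrier \<Gamma>" for g x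
    using up[OF that] by (metis blinfun_apply_blinfun_compose)
  have pu': "p (?u g x) = p x" if "g \<in> carrier \<Gamma>" for g x
    using up[OF that] p_central[OF u[OF that]] by (metis blinfun_apply_blinfun_compose)
  show "p \<notin> group_algebra \<Gamma>"
    using group_algebra_invariant_augmentation[OF G assms(2,3) \<epsilon> \<epsilon>u _ up] assms(10) by fastforce
  have p_fix: "p x = x" if "\<And>g. g \<in> carrier \<Gamma> \<Longrightarrow> ?u g x = x" for x
    using full_cstar_fixed_vector[OF G \<epsilon> \<epsilon>u that p(1)] assms(10) by (simp add: scaleC_one)
  have p_sa: "cinner (p x) y = cinner x (p y)" for x y
    using cinner_adj[OF complex_linear_full_cstar[OF p(1)]] p(3) by simp
  have hom: "star_hom ?A (spatial_tensor ?A ?A) \<Delta>"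
    and \<Delta>u: "\<And>g. g \<in> carrier \<Gamma> \<Longrightarrow> \<Delta> (?u g) = tensor_op (?u g) (?u g)"
    using assms(7) by (auto simp: comultiplication_def)
  have \<Delta>p_linear: "complex_linear (\<Delta> p)"
    by (rule complex_linear_spatial_tensor[where G = \<Gamma>]) (use hom p(1) in \<open>simp add: star_hom_def\<close>)
  have \<Delta>p_sa: "cinner (\<Delta> p x) y = cinner x (\<Delta> p y)" for x y
  proof -
    have "\<Delta> (adj p) = adj (\<Delta> p)" using hom p(1) by (simp add: star_hom_def)
    then show ?thesis using cinner_adj[OF \<Delta>p_linear, of x y] p(3) by simp
  qed
  \<comment> \<open>As \<open>\<Delta> p\<close> is self-adjoint and absorbs \<open>\<Delta> u\<close> on the right, every vector of its range is invariant.\<close>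
  have inv: "cinner (tensor_vec (?u g x) (?u g z)) (\<Delta> p w) = cinner (tensor_vec x z) (\<Delta> p w)"
    if g: "g \<in> carrier \<Gamma>" for g x z w
  proof -
    have "\<Delta> p o\<^sub>L \<Delta> (?u g) = \<Delta> (p o\<^sub>L ?u g)"
      using hom p(1) u[OF g] by (simp add: star_hom_def)
    also have "\<dots> = \<Delta> p" using up[OF g] p_central[OF u[OF g]] by simp
    finally have "\<Delta> p (tensor_op (?u g) (?u g) (tensor_vec x z)) = \<Delta> p (tensor_vec x z)"
      by (metis \<Delta>u[OF g] blinfun_apply_blinfun_compose)
    then show ?thesis
      by (simp add: tensor_op_apply complex_linear_univ_rep g flip: \<Delta>p_sa)
  qed
  \<comment> \<open>The flip of an invariant vector is invariant, so what holds for the second leg holds for the first.\<close>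
  have absorb: "cinner (tensor_vec (p x) (p z)) (\<Delta> p w) = cinner (tensor_vec x z) (\<Delta> p w)" for x z w
  proof -
    have right: "cinner (tensor_vec x (p z)) Y = cinner (tensor_vec x z) Y"
      if "\<And>g x z. g \<in> carrier \<Gamma> \<Longrightarrow> cinner (tensor_vec (?u g x) (?u g z)) Y = cinner (tensor_vec x z) Y"
      for x z and Y :: "('g univ_index \<times> 'g univ_index) ell2"
      by (rule invariant_tensor_absorbs_projection[OF G assms(5) p_sa _ p_fix that])
        (simp_all add: up' pu')
    have "cinner (tensor_vec (p x) (p z)) (\<Delta> p w) = cinner (tensor_vec (p x) z) (\<Delta> p w)"
      by (rule right[OF inv])
    also have "\<dots> = cinner (tensor_vec z (p x)) (flip (\<Delta> p w))" by (simp add: cinner_flip)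
    also have "\<dots> = cinner (tensor_vec z x) (flip (\<Delta> p w))"
      by (rule right) (simp add: cinner_flip inv)
    finally show ?thesis by (simp add: cinner_flip)
  qed
  have \<Delta>p: "\<Delta> p (tensor_vec x z) = tensor_vec (p x) (p z)" for x z
  proof -
    have "\<Delta> p (tensor_vec (p x) (p z)) = tensor_vec (p x) (p z)"
      using comultiplication_fixes_tensor[OF G assms(7) \<epsilon> \<epsilon>u up' up' p(1)] assms(10)
      by (simp add: scaleC_one)
    then have "cinner (\<Delta> p (tensor_vec x z)) w = cinner (tensor_vec (p x) (p z)) w" for w
      using absorb[of x z w] by (simp flip: \<Delta>p_sa)
    then have "cinner w (\<Delta> p (tensor_vec x z)) = cinner w (tensor_vec (p x) (p z))" for w
      by (metis cinner_commute)
    then show ?thesis by (intro ell2_eqI) (metis cinner_unit_vec)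
  qed
  have "\<Delta> p = tensor_op p p"
  proof (rule blinfun_eqI, rule bounded_linear_ell2_eqI[where f = "blinfun_apply (\<Delta> p)"])
    fix c and q :: "'g univ_index \<times> 'g univ_index"
    show "\<Delta> p (c *\<^sub>C unit_vec q) = tensor_op p p (c *\<^sub>C unit_vec q)"
      by (cases q) (simp only: tensor_unit_vec \<Delta>p tensor_op_apply complex_linear_full_cstar[OF p(1)])
  qed (rule blinfun.bounded_linear_right)+
  then show "\<Delta> p \<in> alg_tensor ?A ?A"
    unfolding alg_tensor_def using p(1) by (auto intro: complex_vector.span_base)
qed

end
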